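(* For every $n\ge 2$, the code $\mathcal C_n$ is minimally non-convex.
   Context: A code is a subset $\mathcal C\subseteq 2^{[N]}$. Given convex open sets $U_1,\ldots,U_N$ contained in a convex open set $X\subseteq\mathbb R^d$, their code is $\{\sigma\subseteq[N]\mid \bigcap_{i\in\sigma}U_i\setminus\bigcup_{j\notin\sigma}U_j\neq\emptyset\}$ (empty intersection $=X$); a code is convex if it arises this way for some $d$. For $\sigma\subseteq[N]$, $\mathrm{Tk}_{\mathcal C}(\sigma)=\{c\in\mathcal C\mid\sigma\subseteq c\}$; a trunk in $\mathcal C$ is a subset of $\mathcal C$ that is empty or equal to some $\mathrm{Tk}_{\mathcal C}(\sigma)$. A morphism between codes $\mathcal C\subseteq2^{[N]}$, $\mathcal D\subseteq2^{[M]}$ is a function $f:\mathcal C\to\mathcal D$ such that the preimage of every trunk in $\mathcal D$ is a trunk in $\mathcal C$; an isomorphism is a bijective morphism whose inverse is a morphism. An operation on a code replaces it by one of its trunks (as a code) or by its image under a morphism. For isomorphism classes of codes, $[\mathcal C]\le[\mathcal D]$ if a finite sequence of operations takes $\mathcal D$ to a code isomorphic to $\mathcal C$; this partial order defines the poset $\mathbf{P}_{\mathbf{Code}}$. A code $\mathcal C$ is minimally non-convex if $\mathcal C$ is not convex but every code $\mathcal D$ with $[\mathcal D]<[\mathcal C]$ is convex. For $n\ge2$, $\mathcal C_n\subseteq 2^{[2n+2]}$ is the code consisting of: (i) $\emptyset$; (ii) $\sigma\cup\{n+1\}$ for every nonempty proper subset $\sigma\subsetneq[n]$; (iii) $\{n+1+i\}$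 for $1\le i\le n+1$; (iv) $([n]\setminus\{i\})\cup\{n+1\}\cup\{n+1+i\}$ for $1\le i\le n$; (v) $[n]\cup\{n+1\}\cup\{2n+2\}$; (vi) $\{n+2,n+3,\ldots,2n+2\}$. *)

theory Defs
  imports "HOL-Analysis.Analysis"
begin

text \<open>A code is kept together with its number of neurons: \<open>(N, C)\<close> stands for the code
  \<open>C \<subseteq> Pow {1..N}\<close>.\<close>

type_synonym ncode = "nat \<times> nat set set"

definition is_code :: "nat \<Rightarrow> nat set set \<Rightarrow> bool" where
  "is_code N C \<longleftrightarrow> C \<subseteq> Pow {1..N}"

definition Tk :: "nat set set \<Rightarrow> nat set \<Rightarrow> nat set set" where
  "Tk C \<sigma> = {c \<in> C. \<sigma> \<subseteq> c}"

definition is_trunk :: "nat \<Rightarrow> nat set set \<Rightarrow> nat set set \<Rightarrow> bool" where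
  "is_trunk N C T \<longleftrightarrow> T = {} \<or> (\<exists>\<sigma> \<subseteq> {1..N}. T = Tk C \<sigma>)"

definition code_morphism ::
  "nat \<Rightarrow> nat set set \<Rightarrow> nat \<Rightarrow> nat set set \<Rightarrow> (nat set \<Rightarrow> nat set) \<Rightarrow> bool" where
  "code_morphism N C M D f \<longleftrightarrow>
     f ` C \<subseteq> D \<and> (\<forall>T. is_trunk M D T \<longrightarrow> is_trunk N C {c \<in> C. f c \<in> T})"

definition code_isomorphism ::
  "nat \<Rightarrow> nat set set \<Rightarrow> nat \<Rightarrow> nat set set \<Rightarrow> (nat set \<Rightarrow> nat set) \<Rightarrow> bool" where
  "code_isomorphism N C M D f \<longleftrightarrow>
     bij_betw f C D \<and> code_morphism N C M D f \<and> code_morphism M D N C (inv_into C f)"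

definition isomorphic_codes :: "ncode \<Rightarrow> ncode \<Rightarrow> bool" where
  "isomorphic_codes = (\<lambda>(N, C) (M, D). \<exists>f. code_isomorphism N C M D f)"

inductive code_operation :: "ncode \<Rightarrow> ncode \<Rightarrow> bool" where
  to_trunk: "is_code N C \<Longrightarrow> is_trunk N C T \<Longrightarrow> code_operation (N, C) (N, T)"
| to_image: "is_code N C \<Longrightarrow> is_code M D \<Longrightarrow> code_morphism N C M D f
    \<Longrightarrow> code_operation (N, C) (M, f ` C)"

text \<open>The order of \<open>P\<^sub>C\<^sub>o\<^sub>d\<^sub>e\<close> is expressed on representatives:
  \<open>code_le \<C> \<D>\<close> is \<open>[\<C>] \<le> [\<D>]\<close>, and \<open>[\<C>] = [\<D>]\<close> is \<open>isomorphic_codes \<C> \<D>\<close>.\<close>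

definition code_le :: "ncode \<Rightarrow> ncode \<Rightarrow> bool" where
  "code_le \<C> \<D> \<longleftrightarrow> (\<exists>\<E>. code_operation\<^sup>*\<^sup>* \<D> \<E> \<and> isomorphic_codes \<E> \<C>)"

definition code_less :: "ncode \<Rightarrow> ncode \<Rightarrow> bool" where
  "code_less \<C> \<D> \<longleftrightarrow> code_le \<C> \<D> \<and> \<not> isomorphic_codes \<C> \<D>"

text \<open>Because \<open>d\<close> is existentially quantified in the definition of a convex code, \<open>\<real>\<^sup>d\<close> is
  rendered by \<^const>\<open>Euclidean_space\<close>, whose points are the functions \<open>nat \<Rightarrow> real\<close> vanishing at all
  indices \<open>\<ge> d\<close>. The function type is not an instance of \<^class>\<open>real_vector\<close>, so convexity is
  spelled out as in \<open>convex_alt\<close>.\<close>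

definition convex_coords :: "(nat \<Rightarrow> real) set \<Rightarrow> bool" where
  "convex_coords S \<longleftrightarrow>
     (\<forall>x\<in>S. \<forall>y\<in>S. \<forall>u. 0 \<le> u \<and> u \<le> 1 \<longrightarrow> (\<lambda>i. (1 - u) * x i + u * y i) \<in> S)"

definition convex_open_in :: "nat \<Rightarrow> (nat \<Rightarrow> real) set \<Rightarrow> bool" where
  "convex_open_in d S \<longleftrightarrow> openin (Euclidean_space d) S \<and> convex_coords S"

definition code_of_cover ::
  "nat \<Rightarrow> (nat \<Rightarrow> real) set \<Rightarrow> (nat \<Rightarrow> (nat \<Rightarrow> real) set) \<Rightarrow> nat set set" where
  "code_of_cover N X U =
     {\<sigma>. \<sigma> \<subseteq> {1..N} \<and>
        (if \<sigma> = {} then X else (\<Inter>i\<in>\<sigma>. U i)) - (\<Union>j\<in>{1..N} - \<sigma>. U j) \<noteq> {}}"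

definition convex_code :: "nat \<Rightarrow> nat set set \<Rightarrow> bool" where
  "convex_code N C \<longleftrightarrow>
     (\<exists>d X U. convex_open_in d X \<and> (\<forall>i\<in>{1..N}. convex_open_in d (U i) \<and> U i \<subseteq> X) \<and>
        C = code_of_cover N X U)"

definition minimally_nonconvex :: "nat \<Rightarrow> nat set set \<Rightarrow> bool" where
  "minimally_nonconvex N C \<longleftrightarrow>
     is_code N C \<and> \<not> convex_code N C \<and>
     (\<forall>M D. is_code M D \<and> code_less (M, D) (N, C) \<longrightarrow> convex_code M D)"

definition code_Cn :: "nat \<Rightarrow> nat set set" where
  "code_Cn n =
     {{}}
     \<union> {\<sigma> \<union> {n + 1} |\<sigma>. \<sigma> \<noteq> {} \<and> \<sigma> \<subset> {1..n}}
     \<union> {{n + 1 + i} |i. 1 \<le> i \<and> i \<le> n + 1}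
     \<union> {({1..n} - {i}) \<union> {n + 1} \<union> {n + 1 + i} |i. 1 \<le> i \<and> i \<le> n}
     \<union> {{1..n} \<union> {n + 1} \<union> {2 * n + 2}}
     \<union> {{n + 2..2 * n + 2}}"

end

theory Submission
  imports Defs
begin

text \<open>Suppose \<open>code_Cn n\<close> is realized by \<open>U\<^sub>1, \<dots>, U\<^sub>2\<^sub>n\<^sub>+\<^sub>2\<close>. Choose points
  \<open>p\<^sub>i \<in> U\<^sub>n\<^sub>+\<^sub>1\<^sub>+\<^sub>i \<inter> (\<Inter>j \<noteq> i. U\<^sub>j)\<close> for \<open>i \<le> n\<close>. Their convex hull lies in
  \<open>U\<^sub>n\<^sub>+\<^sub>1 = U\<^sub>1 \<union> \<dots> \<union> U\<^sub>n\<close>, so by Berge's theorem it contains a common point \<open>p\<close> of \<open>U\<^sub>1, \<dots>, U\<^sub>n\<close>,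
  and \<open>p \<in> U\<^sub>2\<^sub>n\<^sub>+\<^sub>2\<close>. But the last \<open>n + 1\<close> sets form a sunflower, and a point of one petal in the
  convex hull of points of other petals lies in the center, which is disjoint from \<open>U\<^sub>1, \<dots>, U\<^sub>n\<close>.

  For minimality, every code strictly below \<open>code_Cn n\<close> is built from trunks while omitting at least
  one of the trunks \<open>Tk {i}\<close>. So it suffices to realize \<open>code_Cn n\<close>, for each \<open>i\<close>, by sets of
  which the \<open>i\<close>-th need not be convex, only its intersections with the sets not containing it.
  The petals are cut out by all but one of \<open>n + 1\<close> (or \<open>n\<close>) affine inequalities.\<close>

section \<open>Convex sets in coordinate space\<close>

text \<open>Regions where all of a fixed list of inequalities hold, except possibly the i-th, form a
  sunflower by construction: two different petals together force the whole list. Take the list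
  \<open>0 < x k\<close> for k \<le> n + 1, let U_(n+1) be the half-space of negative coordinate
  sum, which misses the center, and let U_j be its part with \<open>0 < x j\<close>. All words come
  out right except at one place: points of the half-space whose first n coordinates are nonpositive
  lie in no U_j. Non-convexity of the code makes some defect unavoidable; each realization lets the
  exempt set absorb it. Exempting neuron n + 1 removes these points from U_(n+1); exempting neuron m
  \<le> n gives them to U_m. For a petal, the half-space is replaced by a set \<open>slab\<close> on
  which the sum of the first n coordinates is positive, so that the U_j do cover it; the price is an
  exempt petal in three separate pieces: the center, its part in \<open>slab\<close>, and a part
  carrying this petal alone. In the non-convexity proof, Berge's theorem wants closed sets while
  those of a code are open; erosion by a small radius mediates.\<close>

abbreviation coord_space :: "nat \<Rightarrow> (nat \<Rightarrow> real) set" where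
  "coord_space d \<equiv> topspace (Euclidean_space d)"

abbreviation segment_point :: "(nat \<Rightarrow> real) \<Rightarrow> (nat \<Rightarrow> real) \<Rightarrow> real \<Rightarrow> nat \<Rightarrow> real" where
  "segment_point x y u \<equiv> (\<lambda>i. (1 - u) * x i + u * y i)"

lemma convex_coordsD:
  "convex_coords S \<Longrightarrow> x \<in> S \<Longrightarrow> y \<in> S \<Longrightarrow> 0 \<le> u \<Longrightarrow> u \<le> 1 \<Longrightarrow> segment_point x y u \<in> S"
  unfolding convex_coords_def by blast

lemma convex_coords_Int: "convex_coords S \<Longrightarrow> convex_coords T \<Longrightarrow> convex_coords (S \<inter> T)"
  unfolding convex_coords_def by blast

lemma convex_coords_Inter: "(\<And>S. S \<in> F \<Longrightarrow> convex_coords S) \<Longrightarrow> convex_coords (\<Inter>F)"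
  unfolding convex_coords_def by blast

lemma convex_coords_hull: "convex_coords (convex_coords hull S)"
  by (rule hull_in) (auto intro: convex_coords_Inter)

lemma convex_coords_space: "convex_coords (coord_space d)"
  by (auto simp: convex_coords_def topspace_Euclidean_space)

lemma openin_Euclidean_space_iff:
  "openin (Euclidean_space d) U \<longleftrightarrow> (\<exists>T. open T \<and> U = coord_space d \<inter> T)"
  unfolding topspace_Euclidean_space unfolding Euclidean_space_def
  by (auto simp: euclidean_product_topology openin_open)

text \<open>The product topology gives each coordinate its own radius; points of
  \<open>coord_space d\<close> agree outside the first \<open>d\<close> coordinates, so a minimum
  over finitely many radii suffices.\<close>

lemma openin_Euclidean_space_box:
  assumes "openin (Euclidean_space d) U" "x \<in> U"
  obtains \<delta> where "\<delta> > 0"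
    "\<And>y. y \<in> coord_space d \<Longrightarrow> (\<And>i. i < d \<Longrightarrow> \<bar>x i - y i\<bar> < \<delta>) \<Longrightarrow> y \<in> U"
proof -
  obtain T where T: "open T" "U = coord_space d \<inter> T"
    using assms(1) unfolding openin_Euclidean_space_iff by auto
  have "x \<in> T" using assms T by auto
  have "openin (product_topology (\<lambda>i. euclidean) UNIV) T" using T(1) by (simp add: open_fun_def)
  from product_topology_open_contains_basis[OF this \<open>x \<in> T\<close>] obtain X where
    X: "x \<in> (\<Pi>\<^sub>E i\<in>UNIV. X i)" "\<And>i. open (X i)" "(\<Pi>\<^sub>E i\<in>UNIV. X i) \<subseteq> T"
    by auto
  have "\<exists>e>0. ball (x i) e \<subseteq> X i" for i
    using X(1,2) by (metis PiE_mem UNIV_I open_contains_ball_eq)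
  then obtain e where e: "\<And>i. e i > 0" "\<And>i. ball (x i) (e i) \<subseteq> X i" by metis
  \<comment> \<open>The inserted 1 keeps \<open>Min\<close> meaningful for
    \<open>d = 0\<close>.\<close>
  define \<delta> where "\<delta> = Min (insert 1 (e ` {..<d}))"
  have dpos: "\<delta> > 0" unfolding \<delta>_def using e(1) by auto
  have de: "\<delta> \<le> e i" if "i < d" for i unfolding \<delta>_def using that by (intro Min_le) auto
  show ?thesis
  proof
    fix y assume y: "y \<in> coord_space d" "\<And>i. i < d \<Longrightarrow> \<bar>x i - y i\<bar> < \<delta>"
    have "y i \<in> X i" for i
    proof (cases "i < d")
      case True
      then show ?thesis using y(2)[OF True] de[OF True] e(2)[of i] by (auto simp: dist_real_def)
    next
      case False
      then have "y i = x i"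
        using y(1) assms T by (auto simp: topspace_Euclidean_space)
      then show ?thesis using X(1) by (metis PiE_mem UNIV_I)
    qed
    then show "y \<in> U" using X(3) T(2) y(1) by (auto simp: PiE_iff)
  qed (rule dpos)
qed

text \<open>The filter \<open>at_right 0\<close> lets finitely many smallness conditions be combined
  later without choosing a common bound each time.\<close>

lemma openin_Euclidean_space_line:
  assumes "openin (Euclidean_space d) U" "x \<in> U" "v \<in> coord_space d"
  shows "\<forall>\<^sub>F t in at_right 0. (\<lambda>i. x i + t * v i) \<in> U"
proof -
  obtain \<delta> where \<delta>: "\<delta> > 0"
    "\<And>y. y \<in> coord_space d \<Longrightarrow> (\<And>i. i < d \<Longrightarrow> \<bar>x i - y i\<bar> < \<delta>) \<Longrightarrow> y \<in> U"
    using openin_Euclidean_space_box[OF assms(1,2)] by blast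
  have "x \<in> coord_space d" using assms(1,2) openin_subset by blast
  then have sp: "(\<lambda>i. x i + t * v i) \<in> coord_space d" for t
    using assms(3) by (auto simp: topspace_Euclidean_space)
  have "\<forall>\<^sub>F t in at_right (0::real). \<bar>t * v i\<bar> < \<delta>" for i
  proof -
    have "((\<lambda>t. \<bar>t * v i\<bar>) \<longlongrightarrow> \<bar>0 * v i\<bar>) (at_right 0)" by (intro tendsto_intros)
    then show ?thesis using \<delta>(1) by (auto dest: order_tendstoD(2))
  qed
  then have "\<forall>\<^sub>F t in at_right (0::real). \<forall>i\<in>{..<d}. \<bar>t * v i\<bar> < \<delta>"
    by (intro eventually_ball_finite) auto
  then show ?thesis
    by eventually_elim (auto intro!: \<delta>(2) sp)
qed

section \<open>Strict separation and Berge's theorem\<close>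

text \<open>Moving from \<open>a\<close> towards \<open>x\<close> by the fraction u changes the
  squared distance to \<open>b\<close> by u^2 r - 2 u s; for s > 0 and small u this is negative,
  against minimality.\<close>

lemma closest_point_halfspace:
  fixes a b x :: "nat \<Rightarrow> real"
  assumes "convex_coords A" "a \<in> A" "x \<in> A"
    and closest: "\<And>y. y \<in> A \<Longrightarrow> (\<Sum>i<d. (b i - a i)\<^sup>2) \<le> (\<Sum>i<d. (b i - y i)\<^sup>2)"
  shows "(\<Sum>i<d. (b i - a i) * (x i - a i)) \<le> 0"
proof (rule ccontr)
  define s where "s = (\<Sum>i<d. (b i - a i) * (x i - a i))"
  define r where "r = (\<Sum>i<d. (x i - a i)\<^sup>2)"
  assume "\<not> (\<Sum>i<d. (b i - a i) * (x i - a i)) \<le> 0"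
  then have s: "s > 0" by (simp add: s_def)
  have r: "r \<ge> 0" unfolding r_def by (intro sum_nonneg) auto
  \<comment> \<open>This choice gives u (r + 1) \<le> s, hence u r < s < 2 s; the summand 1 avoids
    division by zero when r = 0.\<close>
  define u where "u = min 1 (s / (r + 1))"
  have u: "0 < u" "u \<le> 1" "u * (r + 1) \<le> s"
    using s r by (auto simp: u_def min_def pos_le_divide_eq)
  have "(\<Sum>i<d. (b i - a i)\<^sup>2) \<le> (\<Sum>i<d. (b i - segment_point a x u i)\<^sup>2)"
    using assms u by (intro closest convex_coordsD) auto
  also have "\<dots> = (\<Sum>i<d. (b i - a i)\<^sup>2 - 2 * u * ((b i - a i) * (x i - a i)) + u\<^sup>2 * (x i - a i)\<^sup>2)"
    by (intro sum.cong) (auto simp: power2_eq_square algebra_simps)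
  also have "\<dots> = (\<Sum>i<d. (b i - a i)\<^sup>2) - 2 * u * s + u\<^sup>2 * r"
    by (simp add: sum.distrib sum_subtractf sum_distrib_left[symmetric] s_def r_def)
  finally have "2 * s \<le> u * r" using u(1) by (simp add: power2_eq_square mult.assoc)
  then show False using u(3) s u(1) by (simp add: algebra_simps)
qed

text \<open>Compactness gives a shortest segment from \<open>A\<close> to \<open>B\<close>; its
  perpendicular bisector is the separating hyperplane, by \<open>closest_point_halfspace\<close> at
  either end.\<close>

lemma separate_compact_convex_coords:
  assumes A: "compact A" "A \<noteq> {}" "convex_coords A" "A \<subseteq> coord_space d"
    and B: "compact B" "B \<noteq> {}" "convex_coords B" "B \<subseteq> coord_space d"
    and disj: "A \<inter> B = {}"
  obtains v c where "\<And>x. x \<in> A \<Longrightarrow> (\<Sum>i<d. v i * x i) < c"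
    "\<And>x. x \<in> B \<Longrightarrow> c < (\<Sum>i<d. v i * x i)"
proof -
  let ?D = "\<lambda>p :: (nat \<Rightarrow> real) \<times> (nat \<Rightarrow> real). \<Sum>i<d. (snd p i - fst p i)\<^sup>2"
  have cont: "continuous_on (A \<times> B) ?D"
    by (intro continuous_intros continuous_on_product_then_coordinatewise)
  have "\<exists>p\<in>A \<times> B. \<forall>q\<in>A \<times> B. ?D p \<le> ?D q"
    by (rule continuous_attains_inf[OF compact_Times[OF A(1) B(1)] _ cont]) (use A(2) B(2) in auto)
  then obtain p where p: "p \<in> A \<times> B" "\<And>q. q \<in> A \<times> B \<Longrightarrow> ?D p \<le> ?D q"
    by blast
  obtain a b where ab: "p = (a, b)" "a \<in> A" "b \<in> B" using p(1) by auto
  have min: "(\<Sum>i<d. (b i - a i)\<^sup>2) \<le> (\<Sum>i<d. (y i - x i)\<^sup>2)" if "x \<in> A" "y \<in> B" for x y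
    using p(2)[of "(x, y)"] that ab by auto
  define v where "v i = b i - a i" for i
  define r where "r = (\<Sum>i<d. (v i)\<^sup>2)"
  have "a \<noteq> b" using ab disj by auto
  then obtain k where k: "a k \<noteq> b k" by blast
  \<comment> \<open>Points of \<open>coord_space d\<close> vanish from index d on, so
    \<open>a\<close> and \<open>b\<close> differ in a coordinate that the distance measures.\<close>
  then have "k < d" using ab A(4) B(4) by (force simp: topspace_Euclidean_space not_le[symmetric])
  then have r: "r > 0"
    unfolding r_def v_def using k by (intro sum_pos2[of _ k]) auto
  have vab: "(\<Sum>i<d. v i * b i) = (\<Sum>i<d. v i * a i) + r"
    unfolding r_def sum.distrib[symmetric]
    by (intro sum.cong refl) (simp add: v_def power2_eq_square algebra_simps)
  have 1: "(\<Sum>i<d. v i * x i) \<le> (\<Sum>i<d. v i * a i)" if "x \<in> A" for x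
    using closest_point_halfspace[OF A(3) ab(2) that, where b=b and d=d] min ab(3)
    by (simp add: v_def[symmetric] right_diff_distrib sum_subtractf)
  have 2: "(\<Sum>i<d. v i * b i) \<le> (\<Sum>i<d. v i * x i)" if "x \<in> B" for x
  proof -
    have "(\<Sum>i<d. (a i - b i)\<^sup>2) \<le> (\<Sum>i<d. (a i - y i)\<^sup>2)" if "y \<in> B" for y
      using min[OF ab(2) that] by (simp add: power2_commute)
    from closest_point_halfspace[OF B(3) ab(3) that this]
    show ?thesis
      by (simp add: v_def left_diff_distrib right_diff_distrib sum_subtractf)
  qed
  define c where "c = (\<Sum>i<d. v i * a i) + r / 2"
  show ?thesis
  proof
    show "(\<Sum>i<d. v i * x i) < c" if "x \<in> A" for x
      using 1[OF that] r unfolding c_def by linarith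
    show "c < (\<Sum>i<d. v i * x i)" if "x \<in> B" for x
      using 2[OF that] vab r unfolding c_def by linarith
  qed
qed

text \<open>If the theorem failed for \<open>J = insert m J'\<close>, a hyperplane would
  strictly separate \<open>T \<inter> (\<Inter>j\<in>J'. C j)\<close> from \<open>T \<inter> C m\<close>, and its section of \<open>T\<close> would violate
  the theorem for \<open>J'\<close>.\<close>

lemma Berge_intersection:
  assumes "finite J" "J \<noteq> {}"
    and "compact T" "convex_coords T" "T \<subseteq> coord_space d"
    and "\<And>j. j \<in> J \<Longrightarrow> closed (C j)" "\<And>j. j \<in> J \<Longrightarrow> convex_coords (C j)"
    and "T \<subseteq> (\<Union>j\<in>J. C j)"
    and "\<And>k. k \<in> J \<Longrightarrow> T \<inter> (\<Inter>j\<in>J - {k}. C j) \<noteq> {}"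
  shows "T \<inter> (\<Inter>j\<in>J. C j) \<noteq> {}"
  using assms
proof (induction J arbitrary: T rule: finite_ne_induct)
  case (singleton k)
  then show ?case by auto
next
  case (insert m J)
  have cvx_Int: "convex_coords (\<Inter>j\<in>K. C j)" if "K \<subseteq> insert m J" for K
    using that insert.prems(5) by (auto intro!: convex_coords_Inter)
  show ?case
  proof
    assume empty: "T \<inter> (\<Inter>j\<in>insert m J. C j) = {}"
    define A where "A = T \<inter> (\<Inter>j\<in>J. C j)"
    define B where "B = T \<inter> C m"
    have "insert m J - {m} = J" using insert.hyps by auto
    then have A_ne: "A \<noteq> {}" using insert.prems(7)[of m] by (simp add: A_def)
    obtain k0 where k0: "k0 \<in> J" using insert.hyps by auto
    then have "m \<in> insert m J - {k0}" using insert.hyps by auto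
    then have B_ne: "B \<noteq> {}" using insert.prems(7)[of k0] k0 unfolding B_def by blast
    obtain v c where v: "\<And>x. x \<in> A \<Longrightarrow> (\<Sum>i<d. v i * x i) < c"
      "\<And>x. x \<in> B \<Longrightarrow> c < (\<Sum>i<d. v i * x i)"
    proof (rule separate_compact_convex_coords[of A d B])
      show "compact A" "compact B"
        unfolding A_def B_def using insert.prems by (auto intro!: compact_Int_closed)
      show "convex_coords A" "convex_coords B"
        unfolding A_def B_def using insert.prems cvx_Int[of J] by (auto intro!: convex_coords_Int)
    qed (use A_ne B_ne insert.prems empty in \<open>auto simp: A_def B_def\<close>)
    define H where "H = {x. (\<Sum>i<d. v i * x i) = c}"
    have lin: "(\<Sum>i<d. v i * segment_point x y u i) =
        (1 - u) * (\<Sum>i<d. v i * x i) + u * (\<Sum>i<d. v i * y i)" for x y u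
      unfolding sum_distrib_left sum.distrib[symmetric]
      by (intro sum.cong refl) (simp add: algebra_simps)
    have "closed H" unfolding H_def
      by (intro closed_Collect_eq continuous_intros continuous_on_product_then_coordinatewise)
    have "convex_coords H" unfolding convex_coords_def H_def
      by (clarsimp simp: lin) (simp add: left_diff_distrib)
    have "(T \<inter> H) \<inter> (\<Inter>j\<in>J. C j) \<noteq> {}"
    proof (rule insert.IH)
      show "compact (T \<inter> H)" "convex_coords (T \<inter> H)" "T \<inter> H \<subseteq> coord_space d"
        using insert.prems \<open>closed H\<close> \<open>convex_coords H\<close>
        by (auto intro!: compact_Int_closed convex_coords_Int)
      \<comment> \<open>\<open>C m\<close> meets \<open>T\<close> only strictly above
        \<open>H\<close>, so the section is covered without it.\<close>
      show "T \<inter> H \<subseteq> (\<Union>j\<in>J. C j)"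
        using insert.prems(6) v(2) unfolding B_def H_def by fastforce
      fix k assume k: "k \<in> J"
      then have mk: "m \<noteq> k" using insert.hyps by auto
      obtain y where y: "y \<in> T \<inter> (\<Inter>j\<in>insert m J - {k}. C j)" using insert.prems(7)[of k] k by auto
      \<comment> \<open>\<open>x\<close> is below \<open>H\<close>, while \<open>y\<close> is in
        \<open>C m\<close> and hence above it. Both lie in every \<open>C j\<close> with j in
        \<open>J - {k}\<close>, so the segment between them stays there and crosses \<open>H\<close>
        at the fraction u.\<close>
      obtain x where x: "x \<in> A" using A_ne by auto
      define \<alpha> where "\<alpha> = (\<Sum>i<d. v i * x i)"
      define \<beta> where "\<beta> = (\<Sum>i<d. v i * y i)"
      have ab: "\<alpha> < c" "c < \<beta>" using v x y mk by (auto simp: \<alpha>_def \<beta>_def B_def)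
      define u where "u = (c - \<alpha>) / (\<beta> - \<alpha>)"
      have "u * (\<beta> - \<alpha>) = c - \<alpha>" using ab by (simp add: u_def)
      then have u: "0 \<le> u" "u \<le> 1" "(1 - u) * \<alpha> + u * \<beta> = c"
      proof -
        show "0 \<le> u" "u \<le> 1" using ab by (auto simp: u_def)
      qed (simp add: algebra_simps)
      have "segment_point x y u \<in> T \<inter> (\<Inter>j\<in>J - {k}. C j)"
        using x y u insert.prems(2) cvx_Int[of "J - {k}"] unfolding A_def
        by (intro convex_coordsD convex_coords_Int) auto
      moreover have "segment_point x y u \<in> H" unfolding H_def using u(3) by (simp add: lin \<alpha>_def \<beta>_def)
      ultimately show "T \<inter> H \<inter> (\<Inter>j\<in>J - {k}. C j) \<noteq> {}" by blast
    qed (use insert.prems in auto)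
    then show False using v(1) unfolding A_def H_def by auto
  qed
qed

section \<open>Compactness of hulls of finite sets\<close>

lemma eventually_at_right_0_exists:
  assumes "\<forall>\<^sub>F e in at_right (0::real). P e"
  shows "\<exists>e>0. P e"
proof -
  obtain b where "b > 0" "\<forall>y>0. y < b \<longrightarrow> P y"
    using assms by (auto simp: eventually_at_right_field)
  then show ?thesis by (intro exI[of _ "b / 2"]) auto
qed

lemma eventually_at_right_0_less:
  assumes "b > 0" shows "\<forall>\<^sub>F e in at_right (0::real). e < b"
  unfolding eventually_at_right_field using assms by blast

text \<open>A point between two points of the cone with apex \<open>p\<close> lies over a point of
  \<open>S\<close>: the heights average to s, and the base points average with weights proportional
  to (1 - w) u and w v.\<close>

lemma convex_coords_join:
  assumes "convex_coords S"
  shows "convex_coords ((\<lambda>(u, x). segment_point p x u) ` ({0..1} \<times> S))"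
    (is "convex_coords ?R")
  unfolding convex_coords_def
proof (intro ballI allI impI)
  fix X Y w assume "X \<in> ?R" "Y \<in> ?R" and w: "0 \<le> w \<and> w \<le> (1::real)"
  then obtain u x v y where h: "u \<in> {0..1}" "v \<in> {0..1}" "x \<in> S" "y \<in> S"
    and XY: "X = segment_point p x u" "Y = segment_point p y v" by auto
  define s where "s = (1 - w) * u + w * v"
  have s0: "0 \<le> (1 - w) * u" "0 \<le> w * v" using h w by auto
  have "(1 - w) * u + w * v \<le> (1 - w) * 1 + w * 1"
    using h w by (intro add_mono mult_left_mono) auto
  then have s: "0 \<le> s" "s \<le> 1" using s0 by (auto simp: s_def)
  \<comment> \<open>For s = 0 both weights vanish; division by zero then gives \<open>z = x\<close>,
    and any point of \<open>S\<close> would do.\<close>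
  define z where "z = segment_point x y (w * v / s)"
  have "w * v / s \<in> {0..1}" using s0 s by (auto simp: s_def divide_le_eq)
  then have z: "z \<in> S" unfolding z_def by (intro convex_coordsD[OF assms h(3,4)]) auto
  have "segment_point X Y w = segment_point p z s"
  proof
    fix i
    have "s * z i = (1 - w) * u * x i + w * v * y i"
    proof (cases "s = 0")
      case True
      then have "(1 - w) * u = 0" "w * v = 0" using s0 unfolding s_def by linarith+
      then show ?thesis using True by (metis add_0 mult_zero_left)
    next
      case False
      then have "s * z i = (s - w * v) * x i + w * v * y i" by (simp add: z_def field_simps)
      then show ?thesis by (simp add: s_def)
    qed
    then show "segment_point X Y w i = segment_point p z s i"
      by (simp add: s_def XY algebra_simps)
  qed
  then show "segment_point X Y w \<in> ?R"
    using s z by (intro image_eqI[of _ _ "(s, z)"]) auto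
qed

text \<open>The hull of the empty set is empty, so for empty \<open>P\<close> the join would lose
  \<open>p\<close>.\<close>

lemma convex_coords_hull_insert:
  assumes "P \<noteq> {}"
  shows "convex_coords hull (insert p P) =
    (\<lambda>(u, x). segment_point p x u) ` ({0..1} \<times> (convex_coords hull P))"
    (is "_ = ?R")
proof (rule hull_unique)
  obtain q where "q \<in> P" using assms by auto
  then have "q \<in> convex_coords hull P" by (rule hull_inc)
  then have "p \<in> ?R" by (intro image_eqI[of _ _ "(0, q)"]) auto
  moreover have "x \<in> ?R" if "x \<in> P" for x
    using that by (intro image_eqI[of _ _ "(1, x)"]) (auto intro: hull_inc)
  ultimately show "insert p P \<subseteq> ?R" by blast
  show "convex_coords ?R" by (intro convex_coords_join convex_coords_hull)
  fix S assume S: "insert p P \<subseteq> S" "convex_coords S"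
  then have "convex_coords hull P \<subseteq> S" by (intro hull_minimal) auto
  then show "?R \<subseteq> S" using S by (auto intro!: convex_coordsD)
qed

text \<open>By \<open>convex_coords_hull_insert\<close>, each added point makes the hull a
  continuous image of the product of an interval with the previous hull.\<close>

lemma compact_convex_coords_hull:
  assumes "finite P" "P \<noteq> {}"
  shows "compact (convex_coords hull P)"
  using assms
proof (induction rule: finite_ne_induct)
  case (singleton p)
  have "convex_coords {p}" by (auto simp: convex_coords_def algebra_simps)
  then show ?case by (simp add: hull_same)
next
  case (insert p P)
  have "continuous_on ({0..1} \<times> (convex_coords hull P))
          (\<lambda>z. (\<lambda>i. (1 - fst z) * p i + fst z * snd z i))"
    by (intro continuous_intros continuous_on_product_then_coordinatewise)
  then show ?case
    unfolding convex_coords_hull_insert[OF insert.hyps(2)]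
    by (intro compact_continuous_image compact_Times insert.IH) (auto simp: case_prod_beta')
qed

section \<open>Closed convex shrinkings of open convex sets\<close>

text \<open>The points whose open sup-norm ball of radius \<open>\<epsilon>\<close> lies in \<open>U\<close>; phrasing this through the
  complement of \<open>U\<close> makes closedness evident.\<close>

definition erosion :: "nat \<Rightarrow> (nat \<Rightarrow> real) set \<Rightarrow> real \<Rightarrow> (nat \<Rightarrow> real) set" where
  "erosion d U \<epsilon> = {x. \<forall>y\<in>coord_space d - U. \<exists>i<d. \<epsilon> \<le> \<bar>x i - y i\<bar>}"

lemma closed_erosion: "closed (erosion d U \<epsilon>)"
proof -
  have "erosion d U \<epsilon> = (\<Inter>y\<in>coord_space d - U. \<Union>i\<in>{..<d}. {x. \<epsilon> \<le> \<bar>x i - y i\<bar>})"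
    by (auto simp: erosion_def)
  then show ?thesis
    by (simp only:) (intro closed_INT ballI closed_UN finite_lessThan closed_Collect_le
        continuous_intros continuous_on_product_then_coordinatewise)
qed

lemma erosion_subset:
  assumes "\<epsilon> > 0" shows "erosion d U \<epsilon> \<inter> coord_space d \<subseteq> U"
  using assms by (force simp: erosion_def)

text \<open>If \<open>y\<close> is within \<epsilon> of a point m between x and x', then translating
  x and x' by y - m moves them by less than \<epsilon>, so they stay in \<open>U\<close>, and
  \<open>y\<close> lies between the translates.\<close>

lemma convex_coords_erosion:
  assumes "convex_coords U"
  shows "convex_coords (erosion d U \<epsilon> \<inter> coord_space d)"
  unfolding convex_coords_def
proof (intro ballI allI impI)
  fix x x' u assume h: "x \<in> erosion d U \<epsilon> \<inter> coord_space d" "x' \<in> erosion d U \<epsilon> \<inter> coord_space d"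
    "(0::real) \<le> u \<and> u \<le> 1"
  define m where "m = segment_point x x' u"
  have msp: "m \<in> coord_space d"
    unfolding m_def using h convex_coords_space by (intro convex_coordsD) auto
  have "\<exists>i<d. \<epsilon> \<le> \<bar>m i - y i\<bar>" if y: "y \<in> coord_space d - U" for y
  proof (rule ccontr)
    assume far: "\<not> (\<exists>i<d. \<epsilon> \<le> \<bar>m i - y i\<bar>)"
    have shifted: "(\<lambda>i. z i + (y i - m i)) \<in> U" if "z \<in> erosion d U \<epsilon> \<inter> coord_space d" for z
    proof (rule ccontr)
      assume "(\<lambda>i. z i + (y i - m i)) \<notin> U"
      moreover have "(\<lambda>i. z i + (y i - m i)) \<in> coord_space d"
        using that y msp by (auto simp: topspace_Euclidean_space)
      moreover have zero: "\<forall>y\<in>coord_space d - U. \<exists>i<d. \<epsilon> \<le> \<bar>z i - y i\<bar>"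
        using that by (simp add: erosion_def)
      ultimately have "\<exists>i<d. \<epsilon> \<le> \<bar>z i - (z i + (y i - m i))\<bar>"
        using bspec[OF zero, of "\<lambda>i. z i + (y i - m i)"] by blast
      then show False using far by auto
    qed
    have "segment_point (\<lambda>i. x i + (y i - m i)) (\<lambda>i. x' i + (y i - m i)) u \<in> U"
      using assms shifted h by (intro convex_coordsD) auto
    also have "segment_point (\<lambda>i. x i + (y i - m i)) (\<lambda>i. x' i + (y i - m i)) u = y"
      by (rule ext) (simp add: m_def algebra_simps)
    finally show False using y by auto
  qed
  then show "segment_point x x' u \<in> erosion d U \<epsilon> \<inter> coord_space d"
    using msp by (auto simp: erosion_def m_def)
qed

text \<open>A whole neighbourhood of \<open>x\<close> survives the erosion, as a compactness
  argument needs; half the radius of a box around \<open>x\<close> inside \<open>U\<close> bounds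
  \<epsilon>.\<close>

lemma eventually_erosion:
  assumes "openin (Euclidean_space d) U" "x \<in> U"
  shows "\<forall>\<^sub>F \<epsilon> in at_right 0. \<forall>y. (\<forall>i<d. \<bar>x i - y i\<bar> < \<epsilon>) \<longrightarrow> y \<in> erosion d U \<epsilon>"
proof -
  obtain \<delta> where \<delta>: "\<delta> > 0"
    "\<And>y. y \<in> coord_space d \<Longrightarrow> (\<And>i. i < d \<Longrightarrow> \<bar>x i - y i\<bar> < \<delta>) \<Longrightarrow> y \<in> U"
    using openin_Euclidean_space_box[OF assms] by blast
  have "\<forall>\<^sub>F \<epsilon> in at_right 0. \<epsilon> < \<delta> / 2"
    by (rule eventually_at_right_0_less) (use \<delta>(1) in simp)
  then show ?thesis
  proof eventually_elim
    case (elim \<epsilon>)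
    have "\<exists>i<d. \<epsilon> \<le> \<bar>y i - z i\<bar>"
      if y: "\<forall>i<d. \<bar>x i - y i\<bar> < \<epsilon>" and z: "z \<in> coord_space d - U" for y z
    proof -
      obtain i where i: "i < d" "\<not> \<bar>x i - z i\<bar> < \<delta>" using \<delta>(2)[of z] z by blast
      moreover have "\<bar>x i - y i\<bar> < \<epsilon>" using y i by blast
      ultimately show ?thesis using elim by (intro exI[of _ i]) linarith
    qed
    then show ?case by (auto simp: erosion_def)
  qed
qed

lemma erosion_antimono: "\<epsilon> \<le> \<delta> \<Longrightarrow> erosion d U \<delta> \<subseteq> erosion d U \<epsilon>"
proof (clarsimp simp: erosion_def)
  fix x y assume "\<epsilon> \<le> \<delta>" "\<forall>y\<in>coord_space d - U. \<exists>i<d. \<delta> \<le> \<bar>x i - y i\<bar>" "y \<in> coord_space d" "y \<notin> U"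
  then obtain i where "i < d" "\<delta> \<le> \<bar>x i - y i\<bar>" by blast
  with \<open>\<epsilon> \<le> \<delta>\<close> show "\<exists>i<d. \<epsilon> \<le> \<bar>x i - y i\<bar>" by (intro exI[of _ i]) auto
qed

text \<open>A Lebesgue number argument: \<open>K\<close> is covered by finitely many boxes, each
  inside a single erosion, and erosions only grow as \<epsilon> decreases.\<close>

lemma eventually_erosion_cover:
  assumes "compact K" "\<And>x. x \<in> K \<Longrightarrow> \<exists>j\<in>J. openin (Euclidean_space d) (U j) \<and> x \<in> U j"
  shows "\<forall>\<^sub>F \<epsilon> in at_right 0. K \<subseteq> (\<Union>j\<in>J. erosion d (U j) \<epsilon>)"
proof -
  have "\<exists>j\<in>J. \<exists>\<epsilon>>0. \<forall>y. (\<forall>i<d. \<bar>x i - y i\<bar> < \<epsilon>) \<longrightarrow> y \<in> erosion d (U j) \<epsilon>" if x: "x \<in> K" for x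
  proof -
    obtain j where j: "j \<in> J" "openin (Euclidean_space d) (U j)" "x \<in> U j" using assms(2)[OF x] by blast
    show ?thesis using j(1) eventually_at_right_0_exists[OF eventually_erosion[OF j(2,3)]] by blast
  qed
  then obtain j e where je: "\<And>x. x \<in> K \<Longrightarrow> j x \<in> J" "\<And>x. x \<in> K \<Longrightarrow> e x > 0"
    "\<And>x y. x \<in> K \<Longrightarrow> (\<forall>i<d. \<bar>x i - y i\<bar> < e x) \<Longrightarrow> y \<in> erosion d (U (j x)) (e x)"
    by metis
  \<comment> \<open>Only the finitely many coordinates below d are constrained, so the box is open
    in the product topology.\<close>
  define O1 where "O1 x = {y. \<forall>i\<in>{..<d}. y i \<in> {x i - e x<..<x i + e x}}" for x :: "nat \<Rightarrow> real"
  have openO: "open (O1 x)" for x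
    unfolding O1_def by (rule product_topology_basis'[of _ "\<lambda>i. {x i - e x<..<x i + e x}" "\<lambda>i. i"]) auto
  have inO: "x \<in> O1 x" if "x \<in> K" for x using je(2)[OF that] by (auto simp: O1_def)
  obtain F where F: "F \<subseteq> K" "finite F" "K \<subseteq> (\<Union>x\<in>F. O1 x)"
  proof (rule compactE_image[OF assms(1), of K O1])
    show "K \<subseteq> (\<Union>x\<in>K. O1 x)" using inO by blast
  qed (use openO in auto)
  have "\<forall>\<^sub>F \<epsilon> in at_right (0::real). \<epsilon> < e x" if "x \<in> F" for x
    by (rule eventually_at_right_0_less) (use je(2) that F(1) in auto)
  then have "\<forall>\<^sub>F \<epsilon> in at_right (0::real). \<forall>x\<in>F. \<epsilon> < e x" using F(2) by (intro eventually_ball_finite) auto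
  then show ?thesis
  proof eventually_elim
    case (elim \<epsilon>)
    show ?case
    proof
      fix y assume "y \<in> K"
      then obtain x where x: "x \<in> F" "y \<in> O1 x" using F(3) by blast
      have "\<bar>x i - y i\<bar> < e x" if "i < d" for i
      proof -
        have "y i \<in> {x i - e x<..<x i + e x}" using x(2) that by (auto simp: O1_def)
        then show ?thesis by auto
      qed
      then have "y \<in> erosion d (U (j x)) (e x)" using je(3) x F(1) by blast
      moreover have "\<epsilon> \<le> e x" using elim x(1) by force
      ultimately have "y \<in> erosion d (U (j x)) \<epsilon>" using erosion_antimono by blast
      then show "y \<in> (\<Union>j\<in>J. erosion d (U j) \<epsilon>)" using je(1) x F(1) by blast
    qed
  qed
qed

text \<open>Berge's theorem for open sets: for one small \<epsilon> the erosions are closed and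
  convex, still cover the hull and still contain the vertices they should. The witness for omitting
  index k is \<open>p k\<close> itself.\<close>

lemma convex_open_cover_of_simplex:
  assumes J: "finite J" "J \<noteq> {}"
    and U: "\<And>j. j \<in> J \<Longrightarrow> convex_open_in d (U j)"
    and p: "\<And>i. i \<in> J \<Longrightarrow> p i \<in> coord_space d" "\<And>i j. i \<in> J \<Longrightarrow> j \<in> J \<Longrightarrow> i \<noteq> j \<Longrightarrow> p i \<in> U j"
    and cover: "convex_coords hull (p ` J) \<subseteq> (\<Union>j\<in>J. U j)"
  shows "convex_coords hull (p ` J) \<inter> (\<Inter>j\<in>J. U j) \<noteq> {}"
proof -
  define K where "K = convex_coords hull (p ` J)"
  have K: "compact K" "convex_coords K" "K \<subseteq> coord_space d"
  proof -
    show "compact K" unfolding K_def by (rule compact_convex_coords_hull) (use J in auto)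
    show "convex_coords K" unfolding K_def by (rule convex_coords_hull)
    show "K \<subseteq> coord_space d" unfolding K_def
      by (rule hull_minimal[where S=convex_coords, OF _ convex_coords_space]) (use p(1) in auto)
  qed
  have pK: "p i \<in> K" if "i \<in> J" for i unfolding K_def using that by (auto intro: hull_inc)
  have "\<exists>j\<in>J. openin (Euclidean_space d) (U j) \<and> x \<in> U j" if xK: "x \<in> K" for x
  proof -
    obtain j where "j \<in> J" "x \<in> U j" using xK cover unfolding K_def by blast
    then show ?thesis using U[of j] unfolding convex_open_in_def by blast
  qed
  from eventually_erosion_cover[OF K(1) this]
  have 1: "\<forall>\<^sub>F \<epsilon> in at_right 0. K \<subseteq> (\<Union>j\<in>J. erosion d (U j) \<epsilon>)" .
  have "\<forall>\<^sub>F \<epsilon> in at_right 0. p i \<in> erosion d (U j) \<epsilon>" if ij: "i \<in> J" "j \<in> J" "i \<noteq> j" for i j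
  proof -
    have "\<forall>\<^sub>F \<epsilon> in at_right 0. \<forall>y. (\<forall>k<d. \<bar>p i k - y k\<bar> < \<epsilon>) \<longrightarrow> y \<in> erosion d (U j) \<epsilon>"
      using eventually_erosion[OF _ p(2)[OF ij]] U[OF ij(2)] by (simp add: convex_open_in_def)
    with eventually_at_right_less[of "0::real"] show ?thesis
    proof eventually_elim
      case (elim \<epsilon>)
      then show ?case using elim(2)[rule_format, of "p i"] by simp
    qed
  qed
  then have 2: "\<forall>\<^sub>F \<epsilon> in at_right 0. \<forall>i\<in>J. \<forall>j\<in>J - {i}. p i \<in> erosion d (U j) \<epsilon>"
    using J(1) by (intro eventually_ball_finite ballI) auto
  obtain \<epsilon> :: real where \<epsilon>: "\<epsilon> > 0" "K \<subseteq> (\<Union>j\<in>J. erosion d (U j) \<epsilon>)"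
      "\<forall>i\<in>J. \<forall>j\<in>J - {i}. p i \<in> erosion d (U j) \<epsilon>"
    using eventually_at_right_0_exists[OF eventually_conj[OF 1 2]] by (elim exE conjE)
  define C where "C j = erosion d (U j) \<epsilon> \<inter> coord_space d" for j
  have clo: "closed (coord_space d)"
    using closedin_Euclidean_imp_closed[of d "coord_space d"] by simp
  have "K \<inter> (\<Inter>j\<in>J. C j) \<noteq> {}"
  proof (rule Berge_intersection[OF J K])
    fix k assume k: "k \<in> J"
    show "closed (C k)" unfolding C_def by (intro closed_Int closed_erosion clo)
    show "convex_coords (C k)" unfolding C_def
      by (rule convex_coords_erosion) (use U[OF k] in \<open>simp add: convex_open_in_def\<close>)
    show "K \<inter> (\<Inter>j\<in>J - {k}. C j) \<noteq> {}"
      using bspec[OF \<epsilon>(3) k] pK[OF k] p(1)[OF k] by (auto simp: C_def)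
  next
    show "K \<subseteq> (\<Union>j\<in>J. C j)" using \<epsilon>(2) K(3) by (auto simp: C_def)
  qed
  moreover have "C j \<subseteq> U j" for j unfolding C_def by (rule erosion_subset[OF \<epsilon>(1)])
  ultimately show ?thesis unfolding K_def by blast
qed

section \<open>Sunflowers of convex open sets\<close>

text \<open>Let \<open>q\<close> be the last point of the closure of \<open>W\<close> on the segment from a point of \<open>W\<close> to \<open>p\<close>.
  Points slightly off \<open>q\<close> in the direction of any \<open>x \<in> P\<close> lie in \<open>V\<close> and in \<open>V' x\<close>, hence in \<open>W\<close>;
  by convexity the same holds for the direction of \<open>p\<close>, so the segment does not leave \<open>W\<close>.\<close>

lemma sunflower_hull:
  assumes "finite P" "convex_open_in d V" "convex_open_in d W" "W \<noteq> {}"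
    and V': "\<And>x. x \<in> P \<Longrightarrow> convex_open_in d (V' x)" "\<And>x. x \<in> P \<Longrightarrow> x \<in> V' x"
      "\<And>x. x \<in> P \<Longrightarrow> V' x \<inter> V = W"
    and p: "p \<in> V" "p \<in> convex_coords hull P"
  shows "p \<in> W"
proof (rule ccontr)
  assume "p \<notin> W"
  have opV: "openin (Euclidean_space d) V" "convex_coords V"
    and opW: "openin (Euclidean_space d) W" "convex_coords W"
    using assms by (auto simp: convex_open_in_def)
  have opV': "openin (Euclidean_space d) (V' x)" "convex_coords (V' x)" if "x \<in> P" for x
    using V'(1)[OF that] by (auto simp: convex_open_in_def)
  have "P \<noteq> {}"
  proof
    assume "P = {}"
    moreover have "convex_coords {}" by (simp add: convex_coords_def)
    ultimately show False using p(2) by (simp add: hull_same)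
  qed
  then have WV: "W \<subseteq> V" using V'(3) by blast
  obtain w where w: "w \<in> W" using assms by auto
  define \<Gamma> where "\<Gamma> = segment_point w p"
  have sp: "p \<in> coord_space d" "w \<in> coord_space d" "\<And>x. x \<in> P \<Longrightarrow> x \<in> coord_space d"
    using p(1) w opV opW opV' V'(2) openin_subset by blast+
  have \<Gamma>_add: "\<Gamma> (t + e) = (\<lambda>i. \<Gamma> t i + e * (p i - w i))" for t e
    by (rule ext) (simp add: \<Gamma>_def algebra_simps)
  have dir: "(\<lambda>i. y i - z i) \<in> coord_space d" if "y \<in> coord_space d" "z \<in> coord_space d" for y z
    using that by (auto simp: topspace_Euclidean_space)
  define T where "T = {t \<in> {0..1}. \<Gamma> t \<in> W}"
  define s where "s = Sup T"
  have T0: "0 \<in> T" using w by (auto simp: T_def \<Gamma>_def)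
  have bdd: "bdd_above T" by (rule bdd_aboveI[of _ 1]) (auto simp: T_def)
  have "s \<le> 1" unfolding s_def using T0 by (intro cSup_least) (blast, simp add: T_def)
  moreover have "0 \<le> s" unfolding s_def by (rule cSup_upper[OF T0 bdd])
  ultimately have s: "0 \<le> s" "s \<le> 1" by auto
  have below: "\<Gamma> t \<in> W" if t: "0 \<le> t" "t < s" for t
  proof -
    obtain t' where t': "t' \<in> T" "t < t'" using t less_cSup_iff[of T t] T0 bdd s_def by auto
    have "segment_point w (\<Gamma> t') (t / t') \<in> W"
      using w t t' opW by (intro convex_coordsD) (auto simp: T_def)
    also have "segment_point w (\<Gamma> t') (t / t') = \<Gamma> t"
      using t t' by (intro ext) (simp add: \<Gamma>_def field_simps)
    finally show ?thesis .
  qed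
  have above: "t \<le> s" if "\<Gamma> t \<in> W" "0 \<le> t" "t \<le> 1" for t
    unfolding s_def using that by (intro cSup_upper bdd) (auto simp: T_def)
  have advance: "\<forall>\<^sub>F e in at_right 0. \<Gamma> (t + e) \<in> W" if "\<Gamma> t \<in> W" for t
    unfolding \<Gamma>_add by (rule openin_Euclidean_space_line[OF opW(1) that dir[OF sp(1,2)]])
  \<comment> \<open>\<open>W\<close> is open, so from a point of it the path can be continued inside
    \<open>W\<close>. This contradicts the choice of s as a supremum unless s = 1, where the path
    ends in \<open>p\<close>.\<close>
  have last: "\<Gamma> s \<notin> W"
  proof
    assume inW: "\<Gamma> s \<in> W"
    have "s \<noteq> 1" using \<open>p \<notin> W\<close> inW by (auto simp: \<Gamma>_def)
    then have "\<forall>\<^sub>F e in at_right (0::real). e < 1 - s"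
      by (intro eventually_at_right_0_less) (use s in auto)
    with advance[OF inW] eventually_at_right_less[of 0]
    have "\<forall>\<^sub>F e in at_right (0::real). False"
      by eventually_elim (use above[of "s + _"] s in force)
    then show False by simp
  qed
  define q where "q = \<Gamma> s"
  have qV: "q \<in> V" unfolding q_def \<Gamma>_def using w WV p(1) s opV by (intro convex_coordsD) auto
  have "s > 0" using last w s by (cases "s = 0") (auto simp: \<Gamma>_def)
  have qsp: "q \<in> coord_space d" using qV opV openin_subset by blast
  have "\<forall>\<^sub>F e in at_right 0. segment_point q x e \<in> W" if x: "x \<in> P" for x
  proof -
    have "\<forall>\<^sub>F e in at_right 0. (\<lambda>i. q i + e * (x i - q i)) \<in> V"
      by (rule openin_Euclidean_space_line[OF opV(1) qV dir[OF sp(3)[OF x] qsp]])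
    moreover have "\<forall>\<^sub>F e in at_right (0::real). e < 1"
      by (rule eventually_at_right_0_less) simp
    ultimately show ?thesis using eventually_at_right_less[of 0]
    proof eventually_elim
      \<comment> \<open>\<open>q\<close> is only known to lie in the closure of \<open>V' x\<close>.
        So the point on the segment from \<open>q\<close> to \<open>x\<close> is rewritten as a
        point between some \<open>\<Gamma> t\<close> with t < s, which is in \<open>W\<close>, and a
        point near \<open>x\<close>, which is in \<open>V' x\<close>.\<close>
      case (elim e)
      have "\<forall>\<^sub>F h in at_right 0. (\<lambda>i. x i + h * (p i - w i)) \<in> V' x"
        using opV'(1)[OF x] V'(2)[OF x] dir[OF sp(1,2)] by (rule openin_Euclidean_space_line)
      moreover have "\<forall>\<^sub>F h in at_right (0::real). h < s * (1 - e) / e"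
        by (rule eventually_at_right_0_less) (use elim \<open>s > 0\<close> in simp)
      ultimately obtain h where h: "0 < h" "h < s * (1 - e) / e" "(\<lambda>i. x i + h * (p i - w i)) \<in> V' x"
        using eventually_at_right_0_exists[OF eventually_conj] by blast
      \<comment> \<open>With the weights 1 - e and e, going back by h e / (1 - e) along the path
        cancels the shift of \<open>x\<close> by h; the bound on h keeps t nonnegative.\<close>
      define t where "t = s - h * e / (1 - e)"
      have "h * e < s * (1 - e)" using h(2) elim by (simp add: pos_less_divide_eq)
      then have t: "0 \<le> t" "t < s"
        using h(1) elim by (auto simp: t_def pos_divide_le_eq)
      have "\<Gamma> t \<in> V' x" using below[OF t] V'(3)[OF x] by blast
      then have "segment_point (\<Gamma> t) (\<lambda>i. x i + h * (p i - w i)) e \<in> V' x"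
        using h elim opV'(2)[OF x] by (intro convex_coordsD) auto
      also have "segment_point (\<Gamma> t) (\<lambda>i. x i + h * (p i - w i)) e = segment_point q x e"
      proof
        fix i
        have "\<Gamma> t = (\<lambda>i. q i + (t - s) * (p i - w i))"
          using \<Gamma>_add[of s "t - s"] by (simp add: q_def)
        moreover have "(1 - e) * (t - s) = - h * e" using elim by (simp add: t_def)
        ultimately have "(1 - e) * \<Gamma> t i = (1 - e) * q i - h * e * (p i - w i)"
          by (simp add: distrib_left mult.assoc[symmetric])
        then show "segment_point (\<Gamma> t) (\<lambda>i. x i + h * (p i - w i)) e i = segment_point q x e i"
          by (simp add: algebra_simps)
      qed
      finally have "segment_point q x e \<in> V' x" .
      moreover have "segment_point q x e \<in> V" using elim(1) by (simp add: algebra_simps)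
      ultimately show ?case using V'(3)[OF x] by blast
    qed
  qed
  then have "\<forall>\<^sub>F e in at_right 0. \<forall>x\<in>P. segment_point q x e \<in> W"
    using assms(1) by (intro eventually_ball_finite) auto
  moreover have "\<forall>\<^sub>F e in at_right (0::real). e < 1"
    by (rule eventually_at_right_0_less) simp
  ultimately obtain e :: real where e: "0 < e" "e < 1" "\<forall>x\<in>P. segment_point q x e \<in> W"
    using eventually_at_right_0_exists[OF eventually_conj] by blast
  \<comment> \<open>The preimage of \<open>W\<close> under the homothety with center
    \<open>q\<close> and ratio e is convex and contains \<open>P\<close>, hence \<open>p\<close>; so
    the path would meet \<open>W\<close> again beyond s.\<close>
  have "convex_coords {y. segment_point q y e \<in> W}"
    unfolding convex_coords_def
  proof (safe)
    fix y z u assume h: "segment_point q y e \<in> W" "segment_point q z e \<in> W" "0 \<le> u" "(u::real) \<le> 1"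
    have "segment_point (segment_point q y e) (segment_point q z e) u \<in> W"
      by (rule convex_coordsD[OF opW(2) h])
    also have "segment_point (segment_point q y e) (segment_point q z e) u
        = segment_point q (segment_point y z u) e"
      by (rule ext) (simp add: algebra_simps)
    finally show "segment_point q (segment_point y z u) e \<in> W" .
  qed
  then have "convex_coords hull P \<subseteq> {y. segment_point q y e \<in> W}"
    using e by (intro hull_minimal) auto
  then have "segment_point q p e \<in> W" using p(2) by auto
  also have "segment_point q p e = \<Gamma> (s + e * (1 - s))"
    by (rule ext) (simp add: q_def \<Gamma>_def algebra_simps)
  finally have inW: "\<Gamma> (s + e * (1 - s)) \<in> W" .
  have "s + e * (1 - s) \<le> s + 1 * (1 - s)" using e s by (intro add_left_mono mult_right_mono) auto
  then have "s + e * (1 - s) \<le> s" using s e by (intro above[OF inW]) auto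
  then have "s = 1" using s e by (auto simp: mult_le_0_iff)
  then show False using inW last by simp
qed

section \<open>The code \<open>C\<^sub>n\<close> and its non-convexity\<close>

text \<open>Read as membership patterns of the points of \<open>X\<close>, the words need no special
  case for the empty one.\<close>

lemma code_of_cover_image:
  assumes "\<And>i. i \<in> {1..N} \<Longrightarrow> U i \<subseteq> X"
  shows "code_of_cover N X U = (\<lambda>x. {i \<in> {1..N}. x \<in> U i}) ` X"
proof (intro set_eqI iffI)
  fix c assume "c \<in> code_of_cover N X U"
  then have c: "c \<subseteq> {1..N}" and
    ne: "(if c = {} then X else (\<Inter>i\<in>c. U i)) - (\<Union>j\<in>{1..N} - c. U j) \<noteq> {}"
    by (auto simp: code_of_cover_def)
  obtain x where x: "x \<in> (if c = {} then X else (\<Inter>i\<in>c. U i))" "x \<notin> (\<Union>j\<in>{1..N} - c. U j)"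
    using ne by blast
  have "x \<in> X"
  proof (cases "c = {}")
    case False
    then obtain i where "i \<in> c" by auto
    moreover have "x \<in> U i" using x(1) \<open>i \<in> c\<close> False by auto
    ultimately show ?thesis using c assms by blast
  qed (use x in simp)
  moreover have "c = {i \<in> {1..N}. x \<in> U i}"
    using x c by (auto split: if_splits)
  ultimately show "c \<in> (\<lambda>x. {i \<in> {1..N}. x \<in> U i}) ` X" by blast
next
  fix c assume "c \<in> (\<lambda>x. {i \<in> {1..N}. x \<in> U i}) ` X"
  then obtain x where x: "x \<in> X" "c = {i \<in> {1..N}. x \<in> U i}" by blast
  then have "x \<in> (if c = {} then X else (\<Inter>i\<in>c. U i)) - (\<Union>j\<in>{1..N} - c. U j)" by simp
  moreover have "c \<subseteq> {1..N}" using x by blast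
  ultimately show "c \<in> code_of_cover N X U" unfolding code_of_cover_def by blast
qed

text \<open>For \<open>n \<ge> 2\<close>, neuron n + 1 occurs in a word of \<open>code_Cn n\<close>
  exactly when some neuron j \<le> n does. So a word is determined by its part
  \<open>\<sigma>\<close> in {1..n} (its facets) and its petals \<open>\<tau>\<close>, renumbered
  from 1.\<close>

definition word :: "nat \<Rightarrow> nat set \<Rightarrow> nat set \<Rightarrow> nat set" where
  "word n \<sigma> \<tau> = \<sigma> \<union> (if \<sigma> = {} then {} else {n + 1}) \<union> (\<lambda>i. n + 1 + i) ` \<tau>"

definition allowed :: "nat \<Rightarrow> nat set \<Rightarrow> nat set \<Rightarrow> bool" where
  "allowed n \<sigma> \<tau> \<longleftrightarrow>
     \<sigma> = {} \<and> (\<tau> = {} \<or> (\<exists>i\<in>{1..n + 1}. \<tau> = {i}) \<or> \<tau> = {1..n + 1}) \<or>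
     \<sigma> \<noteq> {} \<and> \<sigma> \<subset> {1..n} \<and> \<tau> = {} \<or>
     (\<exists>i\<in>{1..n}. \<sigma> = {1..n} - {i} \<and> \<tau> = {i}) \<or>
     \<sigma> = {1..n} \<and> \<tau> = {n + 1}"

lemma allowed_subset: "allowed n \<sigma> \<tau> \<Longrightarrow> \<sigma> \<subseteq> {1..n} \<and> \<tau> \<subseteq> {1..n + 1}"
  by (auto simp: allowed_def)

lemma word_iff:
  assumes "\<sigma> \<subseteq> {1..n}" "\<tau> \<subseteq> {1..n + 1}"
  shows "j \<in> {1..n} \<Longrightarrow> j \<in> word n \<sigma> \<tau> \<longleftrightarrow> j \<in> \<sigma>"
    and "n + 1 \<in> word n \<sigma> \<tau> \<longleftrightarrow> \<sigma> \<noteq> {}"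
    and "i \<in> {1..n + 1} \<Longrightarrow> n + 1 + i \<in> word n \<sigma> \<tau> \<longleftrightarrow> i \<in> \<tau>"
  using assms by (auto simp: word_def)

lemma neuron_cases:
  fixes j n :: nat
  assumes "j \<in> {1..2 * n + 2}"
  obtains "j \<in> {1..n}" | "j = n + 1" | i where "i \<in> {1..n + 1}" "j = n + 1 + i"
proof (cases "j \<le> n + 1")
  case True
  then show ?thesis using that assms by (cases "j = n + 1") auto
next
  case False
  then have "j - (n + 1) \<in> {1..n + 1}" "j = n + 1 + (j - (n + 1))" using assms by auto
  then show ?thesis by (rule that(3))
qed

lemma exists_other_index:
  assumes "n \<ge> 2" shows "\<exists>j\<in>{1..n}. j \<noteq> (i::nat)"
  using assms by (intro bexI[of _ "if i = 1 then 2 else 1"]) auto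

lemma code_Cn_words:
  assumes "n \<ge> 2"
  shows "code_Cn n = {word n \<sigma> \<tau> |\<sigma> \<tau>. allowed n \<sigma> \<tau>}" (is "_ = ?W")
proof
  have img: "(\<lambda>i. n + 1 + i) ` {1..n + 1} = {n + 2..2 * n + 2}"
    using image_add_atLeastAtMost[of "n + 1" 1 "n + 1"] by (simp add: mult_2)
  have ne: "{1..n} - {i} \<noteq> {}" for i
    using exists_other_index[OF assms, of i] by blast
  have in_W: "c \<in> ?W" if "allowed n \<sigma> \<tau>" "c = word n \<sigma> \<tau>" for c \<sigma> \<tau>
    using that by blast
  show "code_Cn n \<subseteq> ?W"
  proof
    fix c assume "c \<in> code_Cn n"
    then consider "c = {}" | \<sigma> where "\<sigma> \<noteq> {}" "\<sigma> \<subset> {1..n}" "c = \<sigma> \<union> {n + 1}"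
      | i where "1 \<le> i" "i \<le> n + 1" "c = {n + 1 + i}"
      | i where "1 \<le> i" "i \<le> n" "c = ({1..n} - {i}) \<union> {n + 1} \<union> {n + 1 + i}"
      | "c = {1..n} \<union> {n + 1} \<union> {2 * n + 2}" | "c = {n + 2..2 * n + 2}"
      unfolding code_Cn_def by blast
    then show "c \<in> ?W"
    proof cases
      case 1
      then show ?thesis by (intro in_W[of "{}" "{}"]) (auto simp: allowed_def word_def)
    next
      case (2 \<sigma>)
      then show ?thesis by (intro in_W[of \<sigma> "{}"]) (auto simp: allowed_def word_def)
    next
      case (3 i)
      then show ?thesis by (intro in_W[of "{}" "{i}"]) (auto simp: allowed_def word_def)
    next
      case (4 i)
      then show ?thesis using ne[of i]
        by (intro in_W[of "{1..n} - {i}" "{i}"]) (auto simp: allowed_def word_def)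
    next
      case 5
      then show ?thesis using assms
        by (intro in_W[of "{1..n}" "{n + 1}"]) (auto simp: allowed_def word_def)
    next
      case 6
      then show ?thesis using img
        by (intro in_W[of "{}" "{1..n + 1}"]) (auto simp: allowed_def word_def)
    qed
  qed
  show "?W \<subseteq> code_Cn n"
  proof
    fix c assume "c \<in> ?W"
    then obtain \<sigma> \<tau> where c: "c = word n \<sigma> \<tau>" and "allowed n \<sigma> \<tau>" by blast
    then consider "\<sigma> = {}" "\<tau> = {}" | i where "\<sigma> = {}" "i \<in> {1..n + 1}" "\<tau> = {i}"
      | "\<sigma> = {}" "\<tau> = {1..n + 1}" | "\<sigma> \<noteq> {}" "\<sigma> \<subset> {1..n}" "\<tau> = {}"
      | i where "i \<in> {1..n}" "\<sigma> = {1..n} - {i}" "\<tau> = {i}" | "\<sigma> = {1..n}" "\<tau> = {n + 1}"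
      unfolding allowed_def by blast
    then show "c \<in> code_Cn n"
    proof cases
      case 1
      then show ?thesis by (simp add: c word_def code_Cn_def)
    next
      case (2 i)
      then have "c = {n + 1 + i}" "1 \<le> i" "i \<le> n + 1" by (auto simp: c word_def)
      then show ?thesis unfolding code_Cn_def by blast
    next
      case 3
      then have "c = {n + 2..2 * n + 2}" using img by (simp add: c word_def)
      then show ?thesis unfolding code_Cn_def by blast
    next
      case 4
      then have "c = \<sigma> \<union> {n + 1}" by (simp add: c word_def)
      then show ?thesis using 4 unfolding code_Cn_def by blast
    next
      case (5 i)
      then have "c = ({1..n} - {i}) \<union> {n + 1} \<union> {n + 1 + i}" "1 \<le> i" "i \<le> n"
        using ne[of i] by (simp_all add: c word_def)
      then show ?thesis unfolding code_Cn_def by blast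
    next
      case 6
      then have "c = {1..n} \<union> {n + 1} \<union> {2 * n + 2}" using assms by (simp add: c word_def mult_2)
      then show ?thesis unfolding code_Cn_def by blast
    qed
  qed
qed

text \<open>This is the sunflower condition on the petals.\<close>

lemma allowed_two_petals:
  "allowed n \<sigma> \<tau> \<Longrightarrow> i \<in> \<tau> \<Longrightarrow> j \<in> \<tau> \<Longrightarrow> i \<noteq> j \<Longrightarrow> \<tau> = {1..n + 1}"
  unfolding allowed_def by blast

lemma is_code_Cn: "n \<ge> 2 \<Longrightarrow> is_code (2 * n + 2) (code_Cn n)"
  by (auto simp: is_code_def code_Cn_words word_def split: if_splits dest!: allowed_subset)

lemma word_inject:
  assumes "allowed n \<sigma> \<tau>" "word n \<sigma> \<tau> = {j \<in> {1..2 * n + 2}. Q j}"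
  shows "\<sigma> = {j \<in> {1..n}. Q j}" "\<tau> = {i \<in> {1..n + 1}. Q (n + 1 + i)}" "Q (n + 1) \<longleftrightarrow> \<sigma> \<noteq> {}"
proof -
  note s = allowed_subset[OF assms(1)]
  note w = word_iff[OF conjunct1[OF s] conjunct2[OF s]]
  show "\<sigma> = {j \<in> {1..n}. Q j}"
    using s w(1) unfolding assms(2) by auto
  show "\<tau> = {i \<in> {1..n + 1}. Q (n + 1 + i)}"
    using s w(3) unfolding assms(2) by auto
  show "Q (n + 1) \<longleftrightarrow> \<sigma> \<noteq> {}" using w(2) unfolding assms(2) by auto
qed

lemma Cn_not_convex:
  assumes n: "n \<ge> 2"
  shows "\<not> convex_code (2 * n + 2) (code_Cn n)"
proof
  assume "convex_code (2 * n + 2) (code_Cn n)"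
  then obtain d X U where
    U: "\<And>i. i \<in> {1..2 * n + 2} \<Longrightarrow> convex_open_in d (U i)" "\<And>i. i \<in> {1..2 * n + 2} \<Longrightarrow> U i \<subseteq> X"
    and C: "code_Cn n = code_of_cover (2 * n + 2) X U"
    unfolding convex_code_def by blast
  have img: "code_Cn n = (\<lambda>x. {i \<in> {1..2 * n + 2}. x \<in> U i}) ` X"
    unfolding C by (rule code_of_cover_image[OF U(2)])
  define \<sigma> where "\<sigma> x = {j \<in> {1..n}. x \<in> U j}" for x
  define \<tau> where "\<tau> x = {i \<in> {1..n + 1}. x \<in> U (n + 1 + i)}" for x
  have point: "allowed n (\<sigma> x) (\<tau> x) \<and> (x \<in> U (n + 1) \<longleftrightarrow> \<sigma> x \<noteq> {})" if x: "x \<in> X" for x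
  proof -
    have "{i \<in> {1..2 * n + 2}. x \<in> U i} \<in> code_Cn n" unfolding img using x by blast
    then obtain s t where "allowed n s t" "word n s t = {i \<in> {1..2 * n + 2}. x \<in> U i}"
      unfolding code_Cn_words[OF n] by fastforce
    with word_inject[OF this] show ?thesis by (simp add: \<sigma>_def \<tau>_def)
  qed
  have realized: "\<exists>x\<in>X. \<sigma> x = s \<and> \<tau> x = t" if st: "allowed n s t" for s t
  proof -
    have "word n s t \<in> code_Cn n" unfolding code_Cn_words[OF n] using st by blast
    then obtain x where "x \<in> X" "word n s t = {i \<in> {1..2 * n + 2}. x \<in> U i}"
      unfolding img by blast
    with word_inject[OF st this(2)] show ?thesis by (auto simp: \<sigma>_def \<tau>_def)
  qed
  have "\<exists>x\<in>X. \<sigma> x = {1..n} - {i} \<and> \<tau> x = {i}" if "i \<in> {1..n}" for i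
    using that by (intro realized) (auto simp: allowed_def)
  then obtain p where p: "\<And>i. i \<in> {1..n} \<Longrightarrow> p i \<in> X" "\<And>i. i \<in> {1..n} \<Longrightarrow> \<sigma> (p i) = {1..n} - {i}"
    "\<And>i. i \<in> {1..n} \<Longrightarrow> \<tau> (p i) = {i}"
    by metis
  \<comment> \<open>By \<open>n \<ge> 2\<close> each \<open>p i\<close> lies in some
    \<open>U j\<close> with j \<le> n, hence in \<open>U (n + 1)\<close>.\<close>
  have ne: "{1..n} - {i} \<noteq> {}" for i
    using exists_other_index[OF n, of i] by blast
  let ?K = "convex_coords hull (p ` {1..n})"
  have "?K \<subseteq> U (n + 1)"
  proof (rule hull_minimal)
    show "p ` {1..n} \<subseteq> U (n + 1)" using point p(1,2) ne by auto
    show "convex_coords (U (n + 1))" using U(1)[of "n + 1"] by (simp add: convex_open_in_def)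
  qed
  moreover have "U (n + 1) \<subseteq> (\<Union>j\<in>{1..n}. U j)"
  proof
    fix x assume x: "x \<in> U (n + 1)"
    then have "x \<in> X" using U(2)[of "n + 1"] by auto
    then have "\<sigma> x \<noteq> {}" using point x by blast
    then show "x \<in> (\<Union>j\<in>{1..n}. U j)" by (auto simp: \<sigma>_def)
  qed
  ultimately have cover: "?K \<subseteq> (\<Union>j\<in>{1..n}. U j)" by blast
  have "?K \<inter> (\<Inter>j\<in>{1..n}. U j) \<noteq> {}"
  proof (rule convex_open_cover_of_simplex[OF _ _ _ _ _ cover])
    show "convex_open_in d (U j)" if "j \<in> {1..n}" for j using U(1) that by simp
    have Usp: "U (n + 1) \<subseteq> coord_space d"
      using U(1)[of "n + 1"] openin_subset by (auto simp: convex_open_in_def)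
    show "p i \<in> coord_space d" if "i \<in> {1..n}" for i
    proof -
      have "p i \<in> ?K" by (rule hull_inc[OF imageI[OF that]])
      then show ?thesis by (rule subsetD[OF subset_trans[OF \<open>?K \<subseteq> U (n + 1)\<close> Usp]])
    qed
    show "p i \<in> U j" if "i \<in> {1..n}" "j \<in> {1..n}" "i \<noteq> j" for i j
    proof -
      have "j \<in> \<sigma> (p i)" unfolding p(2)[OF that(1)] using that by simp
      then show ?thesis by (simp add: \<sigma>_def)
    qed
  qed (use n in auto)
  then obtain q where q: "q \<in> ?K" "\<And>j. j \<in> {1..n} \<Longrightarrow> q \<in> U j" by blast
  have qX: "q \<in> X" using q(2)[of 1] U(2)[of 1] n by auto
  have "\<sigma> q = {1..n}" using q(2) by (auto simp: \<sigma>_def)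
  then have \<tau>q: "\<tau> q = {n + 1}" using point[OF qX] n by (auto simp: allowed_def)
  define V where "V k = U (n + 1 + k)" for k
  have V: "convex_open_in d (V k)" "V k \<subseteq> X" "y \<in> V k \<longleftrightarrow> k \<in> \<tau> y" if "k \<in> {1..n + 1}" for k y
  proof -
    have "n + 1 + k \<in> {1..2 * n + 2}" using that by auto
    then show "convex_open_in d (V k)" "V k \<subseteq> X" unfolding V_def by (rule U)+
    show "y \<in> V k \<longleftrightarrow> k \<in> \<tau> y" unfolding V_def \<tau>_def using that by blast
  qed
  have one: "1 \<in> {1..n + 1}" and last: "n + 1 \<in> {1..n + 1}" by auto
  have full: "k \<in> \<tau> y" if "y \<in> X" "i \<in> \<tau> y" "j \<in> \<tau> y" "i \<noteq> j" "k \<in> {1..n + 1}" for y i j k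
    using allowed_two_petals[OF conjunct1[OF point[OF that(1)]] that(2-4)] that(5) by simp
  have "q \<in> V 1 \<inter> V (n + 1)"
  \<comment> \<open>Any two petals meet in the center, which is written here as
    \<open>V 1 \<inter> V (n + 1)\<close>. The petals are indexed by the points \<open>p i\<close>,
    and \<open>the_elem (\<tau> x)\<close> recovers the index i.\<close>
  proof (rule sunflower_hull[where P = "p ` {1..n}" and d=d and V = "V (n + 1)"
        and V' = "\<lambda>x. V (the_elem (\<tau> x))"])
    show "finite (p ` {1..n})" by simp
    show "convex_open_in d (V (n + 1))" by (rule V(1)[OF last])
    show "convex_open_in d (V 1 \<inter> V (n + 1))"
      using V(1)[OF one] V(1)[OF last] by (auto simp: convex_open_in_def intro: convex_coords_Int)
    obtain w where "w \<in> X" "\<tau> w = {1..n + 1}"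
      using realized[of "{}" "{1..n + 1}"] by (auto simp: allowed_def)
    then have "w \<in> V 1 \<inter> V (n + 1)" using V(3)[OF one] V(3)[OF last] by simp
    then show "V 1 \<inter> V (n + 1) \<noteq> {}" by blast
    show "q \<in> V (n + 1)" unfolding V(3)[OF last] \<tau>q by simp
    show "q \<in> ?K" by (rule q)
  next
    fix x assume "x \<in> p ` {1..n}"
    then obtain i where i: "i \<in> {1..n}" "x = p i" by blast
    have \<tau>x: "\<tau> x = {i}" unfolding i(2) by (rule p(3)[OF i(1)])
    have i': "i \<in> {1..n + 1}" "i \<noteq> n + 1" using i(1) by auto
    show "convex_open_in d (V (the_elem (\<tau> x)))" unfolding \<tau>x by (simp add: V(1)[OF i'(1)])
    have "x \<in> V i" unfolding V(3)[OF i'(1)] \<tau>x by simp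
    then show "x \<in> V (the_elem (\<tau> x))" unfolding \<tau>x by simp
    have "y \<in> V i \<inter> V (n + 1) \<longleftrightarrow> y \<in> V 1 \<inter> V (n + 1)" for y
    proof (cases "y \<in> X")
      case True
      have "1 \<noteq> n + 1" using n by simp
      then show ?thesis
        using full[OF True, of i "n + 1" 1] full[OF True, of 1 "n + 1" i] i'(2)
        unfolding Int_iff V(3)[OF i'(1)] V(3)[OF one] V(3)[OF last] by (meson i'(1) one)
    qed (use V(2)[OF last] in auto)
    then show "V (the_elem (\<tau> x)) \<inter> V (n + 1) = V 1 \<inter> V (n + 1)" unfolding \<tau>x by auto
  qed
  then have "1 \<in> \<tau> q" using V(3)[OF one] by blast
  then show False using \<tau>q n by simp
qed

section \<open>Trunks and morphisms\<close>

lemma Tk_Tk: "Tk (Tk C \<sigma>) \<rho> = Tk C (\<sigma> \<union> \<rho>)"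
  by (auto simp: Tk_def)

lemma is_trunk_subset: "is_trunk N C T \<Longrightarrow> T \<subseteq> C"
  by (auto simp: is_trunk_def Tk_def)

lemma is_trunk_Tk: "\<sigma> \<subseteq> {1..N} \<Longrightarrow> is_trunk N C (Tk C \<sigma>)"
  by (auto simp: is_trunk_def)

lemma is_trunk_refl: "is_trunk N C C"
  unfolding is_trunk_def by (rule disjI2, rule exI[of _ "{}"]) (auto simp: Tk_def)

lemma is_trunk_trans:
  assumes "is_trunk N C S" "is_trunk N S T"
  shows "is_trunk N C T"
proof (cases "T = {}")
  case False
  then obtain \<rho> where \<rho>: "\<rho> \<subseteq> {1..N}" "T = Tk S \<rho>" using assms(2) by (auto simp: is_trunk_def)
  then have "S \<noteq> {}" using False by (auto simp: Tk_def)
  then obtain \<sigma> where "\<sigma> \<subseteq> {1..N}" "S = Tk C \<sigma>" using assms(1) by (auto simp: is_trunk_def)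
  then show ?thesis using \<rho> by (simp add: Tk_Tk is_trunk_Tk)
qed (simp add: is_trunk_def)

lemma is_trunk_of_subcode:
  assumes "is_trunk N C T" "T \<subseteq> S" "S \<subseteq> C"
  shows "is_trunk N S T"
proof (cases "T = {}")
  case False
  then obtain \<rho> where \<rho>: "\<rho> \<subseteq> {1..N}" "T = Tk C \<rho>" using assms(1) by (auto simp: is_trunk_def)
  then have "T = Tk S \<rho>" using assms by (auto simp: Tk_def)
  then show ?thesis using \<rho> is_trunk_Tk by simp
qed (simp add: is_trunk_def)

lemma code_morphismD:
  "code_morphism N C M D f \<Longrightarrow> is_trunk M D T \<Longrightarrow> is_trunk N C {c \<in> C. f c \<in> T}"
  by (auto simp: code_morphism_def)

lemma code_morphism_image: "code_morphism N C M D f \<Longrightarrow> f ` C \<subseteq> D"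
  by (auto simp: code_morphism_def)

lemma code_morphism_ident: "code_morphism N C N C (\<lambda>c. c)"
proof -
  have "{c \<in> C. c \<in> T} = T" if "is_trunk N C T" for T
    using is_trunk_subset[OF that] by auto
  then show ?thesis by (simp add: code_morphism_def)
qed

lemma code_morphism_cong:
  assumes "\<And>c. c \<in> C \<Longrightarrow> f c = g c"
  shows "code_morphism N C M D f \<longleftrightarrow> code_morphism N C M D g"
proof -
  have "{c \<in> C. f c \<in> T} = {c \<in> C. g c \<in> T}" for T using assms by auto
  moreover have "f ` C = g ` C" using assms by auto
  ultimately show ?thesis by (simp add: code_morphism_def)
qed

lemma code_morphism_comp:
  assumes g: "code_morphism N A M B g" and f: "code_morphism M B K D f"
  shows "code_morphism N A K D (f \<circ> g)"
proof -
  have "is_trunk N A {c \<in> A. (f \<circ> g) c \<in> T}" if "is_trunk K D T" for T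
  proof -
    have "{c \<in> A. (f \<circ> g) c \<in> T} = {c \<in> A. g c \<in> {b \<in> B. f b \<in> T}}"
      using code_morphism_image[OF g] by auto
    then show ?thesis using code_morphismD[OF g code_morphismD[OF f that]] by simp
  qed
  then show ?thesis
    using code_morphism_image[OF g] code_morphism_image[OF f] by (auto simp: code_morphism_def)
qed

text \<open>Trunks of the image are restrictions of trunks of \<open>D\<close>, so they have the
  same preimages.\<close>

lemma code_morphism_onto_image:
  assumes f: "code_morphism N C M D f"
  shows "code_morphism N C M (f ` C) f"
proof -
  have "is_trunk N C {c \<in> C. f c \<in> T}" if T: "is_trunk M (f ` C) T" for T
  proof (cases "T = {}")
    case False
    then obtain \<rho> where \<rho>: "\<rho> \<subseteq> {1..M}" "T = Tk (f ` C) \<rho>" using T by (auto simp: is_trunk_def)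
    then have "{c \<in> C. f c \<in> T} = {c \<in> C. f c \<in> Tk D \<rho>}"
      using code_morphism_image[OF f] by (auto simp: Tk_def)
    then show ?thesis using code_morphismD[OF f is_trunk_Tk[OF \<rho>(1)]] by simp
  qed (simp add: is_trunk_def)
  then show ?thesis by (simp add: code_morphism_def)
qed

lemma code_morphism_restrict_trunk:
  assumes g: "code_morphism N S M F g" and T: "is_trunk M F T"
  shows "code_morphism N {c \<in> S. g c \<in> T} M T g"
proof -
  have "is_trunk N {c \<in> S. g c \<in> T} {c \<in> {c \<in> S. g c \<in> T}. g c \<in> R}" if R: "is_trunk M T R" for R
  proof -
    have "{c \<in> {c \<in> S. g c \<in> T}. g c \<in> R} = {c \<in> S. g c \<in> R}" using is_trunk_subset[OF R] by auto
    moreover have "is_trunk N S {c \<in> S. g c \<in> R}"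
      using code_morphismD[OF g is_trunk_trans[OF T R]] .
    ultimately show ?thesis
      using is_trunk_subset[OF R] by (auto intro!: is_trunk_of_subcode[of N S])
  qed
  then show ?thesis by (auto simp: code_morphism_def)
qed

text \<open>Trunks can be moved in front of images: a trunk of the image of \<open>g\<close> is the
  image of its preimage, which is again a trunk. So a sequence of operations collapses to one trunk
  followed by one image.\<close>

lemma code_operations_normal_form:
  assumes "code_operation\<^sup>*\<^sup>* (N, C) \<E>" "is_code N C"
  shows "\<exists>S g. is_trunk N C S \<and> code_morphism N S (fst \<E>) (snd \<E>) g \<and> g ` S = snd \<E>"
  using assms(1)
proof (induction rule: rtranclp_induct)
  case base
  show ?case using is_trunk_refl code_morphism_ident by (intro exI[of _ C] exI[of _ "\<lambda>c. c"]) auto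
next
  case (step \<E> \<F>)
  then obtain S g where S: "is_trunk N C S" and g: "code_morphism N S (fst \<E>) (snd \<E>) g"
    and im: "g ` S = snd \<E>" by blast
  from step.hyps(2) show ?case
  proof cases
    case (to_trunk M E T)
    have T: "is_trunk M E T" and g': "code_morphism N S M E g" using to_trunk g by simp_all
    have "is_trunk N C {c \<in> S. g c \<in> T}"
      using is_trunk_trans[OF S code_morphismD[OF g' T]] .
    moreover have "g ` {c \<in> S. g c \<in> T} = T"
      using im to_trunk is_trunk_subset[OF T] by auto
    ultimately show ?thesis
      using code_morphism_restrict_trunk[OF g' T] to_trunk
      by (intro exI[of _ "{c \<in> S. g c \<in> T}"] exI[of _ g]) simp
  next
    case (to_image M E K D f)
    have g': "code_morphism N S M E g" using to_image g by simp
    have "code_morphism N S K (f ` E) (f \<circ> g)"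
      by (rule code_morphism_comp[OF g' code_morphism_onto_image[OF to_image(5)]])
    moreover have "(f \<circ> g) ` S = f ` E" unfolding image_comp[symmetric] using im to_image by simp
    ultimately show ?thesis using S unfolding to_image fst_conv snd_conv by blast
  qed
qed

lemma code_le_normal_form:
  assumes "code_le (M, D) (N, C)" "is_code N C"
  obtains S g where "is_trunk N C S" "code_morphism N S M D g" "g ` S = D"
proof -
  obtain \<E> where E: "code_operation\<^sup>*\<^sup>* (N, C) \<E>" "isomorphic_codes \<E> (M, D)"
    using assms(1) by (auto simp: code_le_def)
  obtain S g where S: "is_trunk N C S" "code_morphism N S (fst \<E>) (snd \<E>) g" "g ` S = snd \<E>"
    using code_operations_normal_form[OF E(1) assms(2)] by blast
  obtain f where "code_isomorphism (fst \<E>) (snd \<E>) M D f"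
    using E(2) by (auto simp: isomorphic_codes_def split: prod.splits)
  then have "code_morphism (fst \<E>) (snd \<E>) M D f" "f ` snd \<E> = D"
    by (auto simp: code_isomorphism_def bij_betw_def)
  then have "code_morphism N S M D (f \<circ> g)" "(f \<circ> g) ` S = D"
    unfolding image_comp[symmetric] using code_morphism_comp[OF S(2)] S(3) by simp_all
  then show ?thesis by (rule that[OF S(1)])
qed

section \<open>Realizations up to one trunk\<close>

text \<open>With predicates, convexity and openness follow the logical form of a condition:
  conjunctions and finite universal quantifiers are intersections.\<close>

definition convex_open_pred :: "nat \<Rightarrow> ((nat \<Rightarrow> real) \<Rightarrow> bool) \<Rightarrow> bool" where
  "convex_open_pred d P \<longleftrightarrow> convex_open_in d {x \<in> coord_space d. P x}"

lemma convex_open_pred_cong: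
  "(\<And>x. x \<in> coord_space d \<Longrightarrow> P x \<longleftrightarrow> Q x) \<Longrightarrow> convex_open_pred d P \<Longrightarrow> convex_open_pred d Q"
  unfolding convex_open_pred_def by (metis (mono_tags, lifting) Collect_cong)

lemma convex_open_pred_False: "convex_open_pred d (\<lambda>x. False)"
  by (simp add: convex_open_pred_def convex_open_in_def convex_coords_def)

lemma convex_open_pred_True: "convex_open_pred d (\<lambda>x. True)"
  by (simp add: convex_open_pred_def convex_open_in_def convex_coords_space)

lemma convex_open_pred_conj:
  assumes "convex_open_pred d P" "convex_open_pred d Q"
  shows "convex_open_pred d (\<lambda>x. P x \<and> Q x)"
proof -
  have "{x \<in> coord_space d. P x \<and> Q x} = {x \<in> coord_space d. P x} \<inter> {x \<in> coord_space d. Q x}"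
    by auto
  then show ?thesis
    using assms unfolding convex_open_pred_def convex_open_in_def
    by (simp only:) (auto intro!: convex_coords_Int)
qed

lemma convex_open_pred_ball:
  assumes "finite K" "\<And>k. k \<in> K \<Longrightarrow> convex_open_pred d (P k)"
  shows "convex_open_pred d (\<lambda>x. \<forall>k\<in>K. P k x)"
  using assms
  by (induction K rule: finite_induct) (auto intro: convex_open_pred_conj convex_open_pred_True)

text \<open>Continuity is a separate requirement because affine functionals on all of
  \<open>nat \<Rightarrow> real\<close> can be discontinuous in the product topology.\<close>

definition affine_coords :: "((nat \<Rightarrow> real) \<Rightarrow> real) \<Rightarrow> bool" where
  "affine_coords f \<longleftrightarrow> continuous_on UNIV f \<and>
     (\<forall>x y u. f (segment_point x y u) = (1 - u) * f x + u * f y)"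

lemma affine_coords_const: "affine_coords (\<lambda>x. c)"
  by (simp add: affine_coords_def algebra_simps)

lemma affine_coords_nth: "affine_coords (\<lambda>x. x k)"
  by (simp add: affine_coords_def)

lemma affine_coords_sum: "affine_coords (\<lambda>x. \<Sum>k\<in>K. x k)"
  unfolding affine_coords_def
  by (auto intro!: continuous_intros simp: sum.distrib sum_distrib_left)

lemma convex_open_pred_less:
  assumes "affine_coords f" "affine_coords g"
  shows "convex_open_pred d (\<lambda>x. f x < g x)"
proof -
  have "open {x. f x < g x}"
    using assms by (intro open_Collect_less) (auto simp: affine_coords_def)
  then have "openin (Euclidean_space d) (coord_space d \<inter> {x. f x < g x})"
    unfolding openin_Euclidean_space_iff by blast
  moreover have "convex_coords {x. f x < g x}"
    unfolding convex_coords_def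
  proof (safe)
    fix x y u assume h: "f x < g x" "f y < g y" "0 \<le> u" "(u::real) \<le> 1"
    have "(1 - u) * (f x - g x) + u * (f y - g y) < 0"
      using h by (intro convex_bound_lt) auto
    moreover have "f (segment_point x y u) = (1 - u) * f x + u * f y"
      "g (segment_point x y u) = (1 - u) * g x + u * g y"
      using assms unfolding affine_coords_def by blast+
    ultimately show "f (segment_point x y u) < g (segment_point x y u)"
      by (simp only:) (simp add: algebra_simps)
  qed
  then have "convex_coords (coord_space d \<inter> {x. f x < g x})"
    by (intro convex_coords_Int convex_coords_space)
  ultimately show ?thesis
    unfolding convex_open_pred_def convex_open_in_def by (simp add: Int_def)
qed

lemmas convex_open_pred_intros = convex_open_pred_conj convex_open_pred_ball convex_open_pred_less
  affine_coords_const affine_coords_nth affine_coords_sum finite_Diff finite_atLeastAtMost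

text \<open>The points whose word lies in \<open>S\<close> become the ambient set, and their words
  are relabelled by \<open>g\<close>. When \<open>g\<close> is a morphism, each new set comes from a
  trunk.\<close>

lemma convex_code_of_realization:
  assumes \<phi>: "\<phi> ` coord_space d = C" and S: "S \<subseteq> C" "convex_open_pred d (\<lambda>x. \<phi> x \<in> S)"
    and g: "\<And>k. k \<in> {1..M} \<Longrightarrow> convex_open_pred d (\<lambda>x. \<phi> x \<in> S \<and> k \<in> g (\<phi> x))"
    and D: "g ` S = D" "is_code M D"
  shows "convex_code M D"
proof -
  define X where "X = {x \<in> coord_space d. \<phi> x \<in> S}"
  define U where "U k = {x \<in> coord_space d. \<phi> x \<in> S \<and> k \<in> g (\<phi> x)}" for k
  have UX: "U k \<subseteq> X" for k by (auto simp: U_def X_def)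
  have "\<phi> ` X = S" using \<phi> S(1) by (auto simp: X_def)
  then have "D = (\<lambda>x. g (\<phi> x)) ` X" using D(1) by auto
  also have "\<dots> = (\<lambda>x. {k \<in> {1..M}. x \<in> U k}) ` X"
  proof (rule image_cong[OF refl])
    fix x assume x: "x \<in> X"
    then have "g (\<phi> x) \<subseteq> {1..M}" using D by (auto simp: X_def is_code_def)
    then show "g (\<phi> x) = {k \<in> {1..M}. x \<in> U k}" using x by (auto simp: X_def U_def)
  qed
  also have "\<dots> = code_of_cover M X U" by (rule code_of_cover_image[symmetric]) (rule UX)
  finally show ?thesis
    using S(2) g UX unfolding convex_code_def convex_open_pred_def X_def[symmetric] U_def[symmetric]
    by blast
qed

text \<open>\<open>\<phi>\<close> sends each point to its word. The exempt trunk is named as a set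
  of words, so it is exempt under every \<open>\<rho>\<close> with
  \<open>Tk C \<rho> = Tk C {i}\<close>.\<close>

definition realizable_without :: "nat \<Rightarrow> nat set set \<Rightarrow> nat \<Rightarrow> bool" where
  "realizable_without N C i \<longleftrightarrow> (\<exists>d \<phi>. \<phi> ` coord_space d = C \<and>
     (\<forall>T. is_trunk N C T \<longrightarrow> T \<noteq> Tk C {i} \<longrightarrow> convex_open_pred d (\<lambda>x. \<phi> x \<in> T)))"

lemma realizable_withoutI:
  assumes \<phi>: "\<phi> ` coord_space d = C"
    and single: "\<And>j. j \<in> {1..N} \<Longrightarrow> j \<noteq> i \<Longrightarrow> convex_open_pred d (\<lambda>x. j \<in> \<phi> x)"
    and pair: "\<And>j. j \<in> {1..N} \<Longrightarrow> Tk C {i, j} \<noteq> Tk C {i} \<Longrightarrow>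
      convex_open_pred d (\<lambda>x. i \<in> \<phi> x \<and> j \<in> \<phi> x)"
  shows "realizable_without N C i"
  unfolding realizable_without_def
proof (intro exI conjI allI impI)
  show "\<phi> ` coord_space d = C" by fact
  fix T assume T: "is_trunk N C T" "T \<noteq> Tk C {i}"
  have in_C: "\<phi> x \<in> C" if "x \<in> coord_space d" for x using \<phi> that by blast
  show "convex_open_pred d (\<lambda>x. \<phi> x \<in> T)"
  proof (cases "T = {}")
    case True
    then show ?thesis by (simp add: convex_open_pred_False)
  next
    case False
    then obtain \<rho> where \<rho>: "\<rho> \<subseteq> {1..N}" "T = Tk C \<rho>" using T(1) by (auto simp: is_trunk_def)
    then have fin: "finite \<rho>" using finite_subset by blast
    show ?thesis
    proof (cases "i \<in> \<rho>")
      case False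
      have "convex_open_pred d (\<lambda>x. \<forall>j\<in>\<rho>. j \<in> \<phi> x)"
        using fin False \<rho>(1) by (intro convex_open_pred_ball single) auto
      then show ?thesis
        by (rule convex_open_pred_cong[rotated]) (use in_C \<rho> in \<open>auto simp: Tk_def\<close>)
    next
      case True
      define \<rho>' where "\<rho>' = {j \<in> \<rho>. Tk C {i, j} \<noteq> Tk C {i}}"
      have imp: "j \<in> c" if "c \<in> C" "i \<in> c" "j \<in> \<rho> - \<rho>'" for c j
      proof -
        have "c \<in> Tk C {i}" using that by (simp add: Tk_def)
        also have "\<dots> = Tk C {i, j}" using that by (auto simp: \<rho>'_def)
        finally show ?thesis by (simp add: Tk_def)
      qed
      have "\<rho>' \<noteq> {}"
      proof
        assume "\<rho>' = {}"
        then have "Tk C \<rho> = Tk C {i}" using True imp by (auto simp: Tk_def)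
        then show False using T \<rho> by simp
      qed
      have "convex_open_pred d (\<lambda>x. \<forall>j\<in>\<rho>'. i \<in> \<phi> x \<and> j \<in> \<phi> x)"
        using fin \<rho>(1) by (intro convex_open_pred_ball pair) (auto simp: \<rho>'_def)
      moreover have "(\<forall>j\<in>\<rho>'. i \<in> \<phi> x \<and> j \<in> \<phi> x) \<longleftrightarrow> \<phi> x \<in> T" if "x \<in> coord_space d" for x
        using in_C[OF that] imp[of "\<phi> x"] \<open>\<rho>' \<noteq> {}\<close> True \<rho>(2)
        by (auto simp: Tk_def \<rho>'_def)
      ultimately show ?thesis by (rule convex_open_pred_cong[rotated])
    qed
  qed
qed

text \<open>Neuron \<open>k i\<close> detects whether i belongs to a word. Hence \<open>g\<close> is
  injective, and its inverse pulls \<open>Tk C \<rho>\<close> back to the trunk of the neurons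
  \<open>k i\<close> with i in \<open>\<rho>\<close>.\<close>

lemma separating_morphism_isomorphism:
  assumes C: "is_code N C" and g: "code_morphism N C M D g" "g ` C = D"
    and hit: "\<And>i. i \<in> {1..N} \<Longrightarrow> \<exists>k\<in>{1..M}. {c \<in> C. k \<in> g c} = Tk C {i}"
  shows "isomorphic_codes (M, D) (N, C)"
proof -
  obtain k where k: "\<And>i. i \<in> {1..N} \<Longrightarrow> k i \<in> {1..M}"
    "\<And>i. i \<in> {1..N} \<Longrightarrow> {c \<in> C. k i \<in> g c} = Tk C {i}"
    using hit by metis
  have mem: "k i \<in> g c \<longleftrightarrow> i \<in> c" if "c \<in> C" "i \<in> {1..N}" for c i
    using k(2)[OF that(2)] that(1) by (auto simp: Tk_def)
  have inj: "inj_on g C"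
  proof (rule inj_onI)
    fix c c' assume h: "c \<in> C" "c' \<in> C" "g c = g c'"
    then have "i \<in> c \<longleftrightarrow> i \<in> c'" if "i \<in> {1..N}" for i using mem that by metis
    moreover have "c \<subseteq> {1..N}" "c' \<subseteq> {1..N}" using h C by (auto simp: is_code_def)
    ultimately show "c = c'" by blast
  qed
  define h where "h = inv_into C g"
  have hg: "h (g c) = c" if "c \<in> C" for c using inj that by (simp add: h_def)
  have bij: "bij_betw h D C"
    unfolding h_def using inj g(2) by (intro bij_betw_inv_into) (simp add: bij_betw_def)
  have "is_trunk M D {e \<in> D. h e \<in> T}" if T: "is_trunk N C T" for T
  proof (cases "T = {}")
    case False
    then obtain \<rho> where \<rho>: "\<rho> \<subseteq> {1..N}" "T = Tk C \<rho>" using T by (auto simp: is_trunk_def)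
    have "{e \<in> D. h e \<in> T} = Tk D (k ` \<rho>)"
    proof (intro set_eqI)
      fix e show "e \<in> {e \<in> D. h e \<in> T} \<longleftrightarrow> e \<in> Tk D (k ` \<rho>)"
      proof (cases "e \<in> D")
        case True
        then obtain c where c: "c \<in> C" "e = g c" using g(2) by blast
        have "\<rho> \<subseteq> c \<longleftrightarrow> k ` \<rho> \<subseteq> g c" using mem[OF c(1)] \<rho>(1) by blast
        then show ?thesis using True c hg[OF c(1)] by (simp add: Tk_def \<rho>(2))
      qed (simp add: Tk_def)
    qed
    then show ?thesis using k(1) \<rho>(1) by (auto intro!: is_trunk_Tk)
  qed (simp add: is_trunk_def)
  then have "code_morphism M D N C h"
    using bij by (auto simp: code_morphism_def bij_betw_def)
  \<comment> \<open>The inverse of the inverse is compared with \<open>g\<close> on \<open>C\<close>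
    only, which is all that a morphism on \<open>C\<close> sees.\<close>
  moreover have "inv_into D h c = g c" if "c \<in> C" for c
    using bij that hg[OF that] g(2) by (intro inv_into_f_eq) (auto simp: bij_betw_def)
  then have "code_morphism N C M D (inv_into D h)"
    using g(1) code_morphism_cong by metis
  ultimately show ?thesis
    using bij by (auto simp: isomorphic_codes_def code_isomorphism_def)
qed

text \<open>A code strictly below \<open>C\<close> is the image of a trunk \<open>S\<close> of \<open>C\<close>, so its neurons
  correspond to trunks of \<open>S\<close>. Unless \<open>S = C\<close> and all trunks \<open>Tk C {i}\<close> occur among them, a
  realization in which one \<open>Tk C {i}\<close> is not required to be convex suffices.\<close>

lemma convex_below:
  assumes C: "is_code N C"
    and real: "\<And>i. i \<in> {1..N} \<Longrightarrow> realizable_without N C i"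
    and incomparable: "\<And>j. j \<in> {1..N} \<Longrightarrow> \<exists>i\<in>{1..N}. \<not> Tk C {i} \<subseteq> Tk C {j}"
    and D: "is_code M D" "code_less (M, D) (N, C)"
  shows "convex_code M D"
proof -
  have "code_le (M, D) (N, C)" and not_iso: "\<not> isomorphic_codes (M, D) (N, C)"
    using D(2) by (auto simp: code_less_def)
  then obtain S g where S: "is_trunk N C S" and g: "code_morphism N S M D g" "g ` S = D"
    using code_le_normal_form C by metis
  have pre: "is_trunk N C {c \<in> S. k \<in> g c}" if k: "k \<in> {1..M}" for k
  proof -
    have "is_trunk N S {c \<in> S. g c \<in> Tk D {k}}"
      using k by (intro code_morphismD[OF g(1)] is_trunk_Tk) auto
    also have "{c \<in> S. g c \<in> Tk D {k}} = {c \<in> S. k \<in> g c}" using g(2) by (auto simp: Tk_def)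
    finally show ?thesis by (rule is_trunk_trans[OF S])
  qed
  have conv: "convex_code M D"
    if i: "i \<in> {1..N}" "S = C \<or> S \<noteq> Tk C {i}" "\<And>k. k \<in> {1..M} \<Longrightarrow> {c \<in> S. k \<in> g c} \<noteq> Tk C {i}" for i
  proof -
    obtain d \<phi> where \<phi>: "\<phi> ` coord_space d = C"
      "\<And>T. is_trunk N C T \<Longrightarrow> T \<noteq> Tk C {i} \<Longrightarrow> convex_open_pred d (\<lambda>x. \<phi> x \<in> T)"
      using real[OF i(1)] by (auto simp: realizable_without_def)
    have "convex_open_pred d (\<lambda>x. \<phi> x \<in> S)"
    proof (cases "S = C")
      case True
      then show ?thesis using \<phi>(1) by (intro convex_open_pred_cong[OF _ convex_open_pred_True]) auto
    qed (use i(2) \<phi>(2) S in auto)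
    moreover have "convex_open_pred d (\<lambda>x. \<phi> x \<in> S \<and> k \<in> g (\<phi> x))" if "k \<in> {1..M}" for k
      using \<phi>(2)[OF pre i(3), OF that that] by simp
    ultimately show ?thesis
      using convex_code_of_realization[OF \<phi>(1) is_trunk_subset[OF S]] g(2) D(1) by blast
  qed
  show ?thesis
  proof (cases "S = C")
    case True
    then obtain i where "i \<in> {1..N}" "\<And>k. k \<in> {1..M} \<Longrightarrow> {c \<in> S. k \<in> g c} \<noteq> Tk C {i}"
      using separating_morphism_isomorphism[OF C] g not_iso by blast
    then show ?thesis using conv True by blast
  next
    case False
    have below: "\<exists>j\<in>{1..N}. S \<subseteq> Tk C {j}" if ne: "S \<noteq> {}"
    proof -
      obtain \<rho> where \<rho>: "\<rho> \<subseteq> {1..N}" "S = Tk C \<rho>" using S ne by (auto simp: is_trunk_def)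
      then have "\<rho> \<noteq> {}" using False by (auto simp: Tk_def)
      then obtain j where "j \<in> \<rho>" by blast
      then show ?thesis using \<rho> by (intro bexI[of _ j]) (auto simp: Tk_def)
    qed
    show ?thesis
    proof (cases "S = {}")
      case True
      then have "D = {}" using g(2) by simp
      \<comment> \<open>The empty code is realized in an empty ambient set.\<close>
      moreover have "code_of_cover M {} (\<lambda>_. {}) = {}" by (subst code_of_cover_image) auto
      moreover have "convex_open_in 0 {}" by (simp add: convex_open_in_def convex_coords_def)
      ultimately show ?thesis unfolding convex_code_def by (intro exI) auto
    next
      case False
      then obtain j where j: "j \<in> {1..N}" "S \<subseteq> Tk C {j}" using below by blast
      \<comment> \<open>All trunks met from here on are subsets of \<open>S\<close>, hence of
        \<open>Tk C {j}\<close>, so a trunk not contained in \<open>Tk C {j}\<close> can safely be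
        exempt.\<close>
      obtain i where i: "i \<in> {1..N}" "\<not> Tk C {i} \<subseteq> Tk C {j}" using incomparable[OF j(1)] by blast
      have "{c \<in> S. k \<in> g c} \<noteq> Tk C {i}" for k using i(2) j(2) by blast
      moreover have "S \<noteq> Tk C {i}" using i(2) j(2) by blast
      ultimately show ?thesis using conv[OF i(1)] by blast
    qed
  qed
qed

section \<open>Realizations of \<open>C\<^sub>n\<close> up to one trunk\<close>

text \<open>\<open>P\<close> is to be the set of indices whose inequality holds at a point. Petal i
  asks for all inequalities but the i-th, so the value is empty, a singleton or all of
  \<open>I\<close>, as in the code.\<close>

definition petals :: "nat set \<Rightarrow> nat set \<Rightarrow> nat set" where
  "petals I P = {i \<in> I. I - {i} \<subseteq> P}"

lemma petals_all: "petals I I = I"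
  by (auto simp: petals_def)

lemma petals_one: "i \<in> I \<Longrightarrow> petals I (I - {i}) = {i}"
  by (auto simp: petals_def)

lemma petals_none: "i \<in> I \<Longrightarrow> j \<in> I \<Longrightarrow> i \<noteq> j \<Longrightarrow> i \<notin> P \<Longrightarrow> j \<notin> P \<Longrightarrow> petals I P = {}"
  by (auto simp: petals_def)

lemma petals_cases:
  assumes "P \<subseteq> I"
  obtains "P = I" "petals I P = I"
    | i where "i \<in> I" "P = I - {i}" "petals I P = {i}"
    | "P \<noteq> I" "\<And>i. i \<in> I \<Longrightarrow> P \<noteq> I - {i}" "petals I P = {}"
proof (cases "P = I")
  case True
  then show ?thesis using that(1) petals_all by simp
next
  case False
  show ?thesis
  proof (cases "\<exists>i\<in>I. P = I - {i}")
    case True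
    then show ?thesis using that(2) petals_one by blast
  next
    case nex: False
    obtain i where i: "i \<in> I" "i \<notin> P" using False assms by blast
    moreover obtain j where "j \<in> I" "j \<notin> P" "i \<noteq> j" using nex i assms by blast
    ultimately have "petals I P = {}" using petals_none by blast
    then show ?thesis using that(3) False nex by blast
  qed
qed

text \<open>\<open>b\<close> records whether the point is in U_(n+1), which must avoid the center.
  If \<open>b\<close> holds and exactly one inequality fails, facets and petal fit together: failing
  i \<le> n gives {1..n} - {i} with petal i, and failing n + 1 gives {1..n} with petal n +
  1.\<close>

lemma allowed_petals:
  assumes n: "n \<ge> 2" and P: "P \<subseteq> {1..n + 1}" and b: "b \<Longrightarrow> P \<noteq> {1..n + 1}"
  shows "allowed n (if b then P \<inter> {1..n} else {}) (petals {1..n + 1} P)"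
  using P
proof (cases rule: petals_cases)
  case 1
  then show ?thesis using b by (auto simp: allowed_def)
next
  case (2 i)
  show ?thesis
  proof (cases "b \<and> i = n + 1")
    case True
    then have "P \<inter> {1..n} = {1..n}" using 2(2) by fastforce
    then show ?thesis using True 2 by (auto simp: allowed_def)
  next
    case False
    have "P \<inter> {1..n} = {1..n} - {i}" unfolding 2(2) by auto
    moreover have "b \<Longrightarrow> i \<in> {1..n}" using False 2(1) by auto
    ultimately show ?thesis unfolding allowed_def 2(3) using 2(1) by (cases b) simp_all
  qed
next
  case 3
  have "P \<inter> {1..n} \<noteq> {1..n}"
  proof
    assume full: "P \<inter> {1..n} = {1..n}"
    have "j \<in> P" if "j \<in> {1..n + 1}" "j \<noteq> n + 1" for j
    proof -
      have "j \<in> {1..n}" using that by auto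
      then show ?thesis using full by blast
    qed
    then have "P = {1..n + 1} \<or> P = {1..n + 1} - {n + 1}"
      using P by (cases "n + 1 \<in> P") blast+
    then show False using 3 by auto
  qed
  then show ?thesis using 3 by (auto simp: allowed_def)
qed

text \<open>Converse of \<open>allowed_petals\<close>. The last equivalence excludes patterns with
  \<open>b\<close> but without facets, on which the realization exempting a facet alters
  \<open>\<sigma>\<close>.\<close>

lemma allowed_obtain_petals:
  assumes n: "n \<ge> 2" and st: "allowed n s t"
  obtains b P where "P \<subseteq> {1..n + 1}" "b \<Longrightarrow> P \<noteq> {1..n + 1}"
    "s = (if b then P \<inter> {1..n} else {})" "t = petals {1..n + 1} P" "b \<longleftrightarrow> s \<noteq> {}"
proof -
  let ?I = "{1..n + 1}"
  from st consider "s = {}" "t = {}" | i where "s = {}" "i \<in> ?I" "t = {i}" | "s = {}" "t = ?I"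
    | "s \<noteq> {}" "s \<subset> {1..n}" "t = {}" | i where "i \<in> {1..n}" "s = {1..n} - {i}" "t = {i}"
    | "s = {1..n}" "t = {n + 1}"
    unfolding allowed_def by blast
  then show ?thesis
  proof cases
    case 1
    have "petals ?I {} = {}" by (rule petals_none[of 1 _ "n + 1"]) (use n in auto)
    then show ?thesis using that[of "{}" False] 1 by simp
  next
    case (2 i)
    then show ?thesis using petals_one[of i ?I] by (intro that[of "?I - {i}" False]) simp_all
  next
    case 3
    then show ?thesis using that[of ?I False] petals_all by simp
  next
    case 4
    then obtain j where j: "j \<in> {1..n}" "j \<notin> s" by blast
    have "petals ?I s = {}" by (rule petals_none[of j _ "n + 1"]) (use j 4 in auto)
    moreover have "s \<subseteq> ?I" "s \<noteq> ?I" "s \<inter> {1..n} = s" using 4 j by auto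
    ultimately show ?thesis using that[of s True] 4 by simp
  next
    case (5 i)
    have "s \<noteq> {}" using exists_other_index[OF n, of i] unfolding 5(2) by blast
    moreover have "(?I - {i}) \<inter> {1..n} = s" unfolding 5(2) by auto
    moreover have "i \<in> ?I" using 5(1) by simp
    then have "?I - {i} \<noteq> ?I" "i \<in> ?I" by blast+
    ultimately show ?thesis
      using petals_one[of i ?I] 5(3) by (intro that[of "?I - {i}" True]) simp_all
  next
    case 6
    have last: "n + 1 \<in> ?I" by simp
    then have "?I - {n + 1} \<noteq> ?I" by blast
    moreover have "s \<noteq> {}" unfolding 6(1) using n by simp
    moreover have "s = (?I - {n + 1}) \<inter> {1..n}" unfolding 6(1) by auto
    moreover have "t = petals ?I (?I - {n + 1})" unfolding 6(2) petals_one[OF last] ..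
    ultimately show ?thesis by (intro that[of "?I - {n + 1}" True]) (blast, simp_all only: if_True simp_thms)
  qed
qed

text \<open>Splits \<open>realizable_withoutI\<close> by facets, their union and petals. The pair
  with neuron n + 1 matters only for n + 1 < i: for i \<le> n every word containing i contains n +
  1, so that pair is the exempt trunk itself.\<close>

lemma Cn_realizableI:
  assumes n: "n \<ge> 2"
    and allowed: "\<And>x. x \<in> coord_space d \<Longrightarrow> allowed n (\<sigma> x) (\<tau> x)"
    and realized: "\<And>s t. allowed n s t \<Longrightarrow> \<exists>x\<in>coord_space d. \<sigma> x = s \<and> \<tau> x = t"
    and single: "\<And>j. j \<in> {1..n} \<Longrightarrow> j \<noteq> i \<Longrightarrow> convex_open_pred d (\<lambda>x. j \<in> \<sigma> x)"
      "n + 1 \<noteq> i \<Longrightarrow> convex_open_pred d (\<lambda>x. \<sigma> x \<noteq> {})"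
      "\<And>k. k \<in> {1..n + 1} \<Longrightarrow> n + 1 + k \<noteq> i \<Longrightarrow> convex_open_pred d (\<lambda>x. k \<in> \<tau> x)"
    and pair: "\<And>j. j \<in> {1..n} \<Longrightarrow> j \<noteq> i \<Longrightarrow> convex_open_pred d (\<lambda>x. i \<in> word n (\<sigma> x) (\<tau> x) \<and> j \<in> \<sigma> x)"
      "n + 1 < i \<Longrightarrow> convex_open_pred d (\<lambda>x. i \<in> word n (\<sigma> x) (\<tau> x) \<and> \<sigma> x \<noteq> {})"
      "\<And>k. k \<in> {1..n + 1} \<Longrightarrow> n + 1 + k \<noteq> i \<Longrightarrow>
        convex_open_pred d (\<lambda>x. i \<in> word n (\<sigma> x) (\<tau> x) \<and> k \<in> \<tau> x)"
  shows "realizable_without (2 * n + 2) (code_Cn n) i"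
proof (rule realizable_withoutI[where \<phi> = "\<lambda>x. word n (\<sigma> x) (\<tau> x)" and d = d])
  have sub: "\<sigma> x \<subseteq> {1..n}" "\<tau> x \<subseteq> {1..n + 1}" if "x \<in> coord_space d" for x
    using allowed_subset[OF allowed[OF that]] by auto
  have w: "j \<in> {1..n} \<Longrightarrow> j \<in> word n (\<sigma> x) (\<tau> x) \<longleftrightarrow> j \<in> \<sigma> x"
    "n + 1 \<in> word n (\<sigma> x) (\<tau> x) \<longleftrightarrow> \<sigma> x \<noteq> {}"
    "k \<in> {1..n + 1} \<Longrightarrow> n + 1 + k \<in> word n (\<sigma> x) (\<tau> x) \<longleftrightarrow> k \<in> \<tau> x"
    if "x \<in> coord_space d" for x j k
    using word_iff[OF sub(1)[OF that] sub(2)[OF that]] by blast+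
  show "(\<lambda>x. word n (\<sigma> x) (\<tau> x)) ` coord_space d = code_Cn n"
    unfolding code_Cn_words[OF n] using allowed realized by blast
  fix j assume j: "j \<in> {1..2 * n + 2}"
  show "convex_open_pred d (\<lambda>x. j \<in> word n (\<sigma> x) (\<tau> x))" if ji: "j \<noteq> i"
    using j
  proof (cases rule: neuron_cases)
    case 1
    show ?thesis by (rule convex_open_pred_cong[OF _ single(1)[OF 1 ji]]) (use w(1) 1 in blast)
  next
    case 2
    then have "n + 1 \<noteq> i" using ji by blast
    then show ?thesis unfolding 2
      by (intro convex_open_pred_cong[OF _ single(2)]) (use w(2) in blast)+
  next
    case (3 k)
    then have "n + 1 + k \<noteq> i" using ji by blast
    then show ?thesis unfolding 3(2)
      by (intro convex_open_pred_cong[OF _ single(3)[OF 3(1)]]) (use w(3) 3(1) in blast)+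
  qed
  show "convex_open_pred d (\<lambda>x. i \<in> word n (\<sigma> x) (\<tau> x) \<and> j \<in> word n (\<sigma> x) (\<tau> x))"
    if ne: "Tk (code_Cn n) {i, j} \<noteq> Tk (code_Cn n) {i}"
  proof -
    have ji: "j \<noteq> i" using ne by auto
    have in_C: "word n (\<sigma> x) (\<tau> x) \<in> code_Cn n" if "x \<in> coord_space d" for x
      unfolding code_Cn_words[OF n] using allowed[OF that] by blast
    from j show ?thesis
    proof (cases rule: neuron_cases)
      case 1
      show ?thesis by (rule convex_open_pred_cong[OF _ pair(1)[OF 1 ji]]) (use w(1) 1 in blast)
    next
      case 2
      have "n + 1 < i"
      proof (rule ccontr)
        assume "\<not> n + 1 < i"
        then have "i < n + 1" using 2 ji by simp
        have "n + 1 \<in> c" if c: "c \<in> code_Cn n" "i \<in> c" for c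
        proof -
          obtain s t where st: "allowed n s t" "c = word n s t"
            using c(1) unfolding code_Cn_words[OF n] by blast
          have "s \<noteq> {}" using st c(2) \<open>i < n + 1\<close> by (auto simp: word_def)
          then show ?thesis using st(2) by (simp add: word_def)
        qed
        then show False using ne 2 by (auto simp: Tk_def)
      qed
      then show ?thesis unfolding 2
        by (intro convex_open_pred_cong[OF _ pair(2)]) (use w(2) in blast)+
    next
      case (3 k)
      then have "n + 1 + k \<noteq> i" using ji by blast
      then show ?thesis unfolding 3(2)
        by (intro convex_open_pred_cong[OF _ pair(3)[OF 3(1)]]) (use w(3) 3(1) in blast)+
    qed
  qed
qed

section \<open>Realizations exempting a facet or the union of facets\<close>

definition low :: "nat \<Rightarrow> (nat \<Rightarrow> real) \<Rightarrow> bool" where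
  "low n x \<longleftrightarrow> (\<Sum>k\<in>{1..n + 1}. x k) < 0"

definition pos :: "nat set \<Rightarrow> (nat \<Rightarrow> real) \<Rightarrow> nat set" where
  "pos I x = {k \<in> I. 0 < x k}"

lemma low_pos: "low n x \<Longrightarrow> pos {1..n + 1} x \<noteq> {1..n + 1}"
proof
  assume "low n x" "pos {1..n + 1} x = {1..n + 1}"
  have "0 \<le> (\<Sum>k\<in>{1..n + 1}. x k)"
  proof (rule sum_nonneg)
    fix k assume "k \<in> {1..n + 1}"
    then have "k \<in> pos {1..n + 1} x" using \<open>pos {1..n + 1} x = {1..n + 1}\<close> by blast
    then show "0 \<le> x k" by (simp add: pos_def)
  qed
  then show False using \<open>low n x\<close> by (simp add: low_def)
qed

lemma mem_petals_pos: "k \<in> I \<Longrightarrow> k \<in> petals I (pos I x) \<longleftrightarrow> (\<forall>l\<in>I - {k}. 0 < x l)"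
  by (auto simp: petals_def pos_def)

lemma low_pos_point:
  assumes P: "P \<subseteq> {1..n + 1}" "b \<Longrightarrow> P \<noteq> {1..n + 1}"
  obtains x where "x \<in> coord_space (n + 2)" "pos {1..n + 1} x = P" "low n x \<longleftrightarrow> b"
proof
  \<comment> \<open>One coordinate -(n + 1) outweighs the at most n coordinates equal to 1; without
    \<open>b\<close> no coordinate is negative. Indices run from 1 to n + 1, hence dimension n +
    2.\<close>
  define x :: "nat \<Rightarrow> real" where
    "x k = (if k \<in> {1..n + 1} then if k \<in> P then 1 else if b then - real (n + 1) else 0 else 0)" for k
  show "x \<in> coord_space (n + 2)" by (auto simp: topspace_Euclidean_space x_def)
  show "pos {1..n + 1} x = P" using P(1) by (auto simp: pos_def x_def)
  show "low n x \<longleftrightarrow> b"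
  proof (cases b)
    case True
    then obtain i where i: "i \<in> {1..n + 1}" "i \<notin> P" using P by blast
    have "(\<Sum>k\<in>{1..n + 1}. x k) = x i + (\<Sum>k\<in>{1..n + 1} - {i}. x k)"
      by (rule sum.remove) (use i in auto)
    also have "\<dots> \<le> - real (n + 1) + (\<Sum>k\<in>{1..n + 1} - {i}. 1)"
      using i True by (intro add_mono sum_mono) (auto simp: x_def)
    also have "\<dots> = -1" using i by simp
    finally show ?thesis using True by (simp add: low_def)
  next
    case False
    have "0 \<le> (\<Sum>k\<in>{1..n + 1}. x k)" using False by (intro sum_nonneg) (auto simp: x_def)
    then show ?thesis using False by (simp add: low_def)
  qed
qed

lemma convex_open_pred_low: "convex_open_pred d (low n)"
  unfolding low_def by (intro convex_open_pred_intros)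

lemma convex_open_pred_pos: "convex_open_pred d (\<lambda>x. 0 < x k)"
  by (intro convex_open_pred_intros)

lemma convex_open_pred_petals:
  assumes "finite I" "k \<in> I"
  shows "convex_open_pred d (\<lambda>x. k \<in> petals I (pos I x))"
  unfolding mem_petals_pos[OF assms(2)] using assms(1) by (intro convex_open_pred_intros)

text \<open>Inside a petal, \<open>n \<ge> 2\<close> leaves a positive coordinate among the first n.
  So the exempt union meets each petal exactly where the whole half-space does.\<close>

lemma Cn_realizable_without_union:
  assumes n: "n \<ge> 2"
  shows "realizable_without (2 * n + 2) (code_Cn n) (n + 1)"
proof -
  let ?I = "{1..n + 1}"
  define \<sigma> where "\<sigma> x = (if low n x then pos ?I x \<inter> {1..n} else {})" for x
  define \<tau> where "\<tau> x = petals ?I (pos ?I x)" for x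
  have al: "allowed n (\<sigma> x) (\<tau> x)" for x
    unfolding \<sigma>_def \<tau>_def using low_pos by (intro allowed_petals[OF n]) (auto simp: pos_def)
  have w: "n + 1 \<in> word n (\<sigma> x) (\<tau> x) \<longleftrightarrow> \<sigma> x \<noteq> {}" for x
    using allowed_subset[OF al[of x]] by (intro word_iff) auto
  have mem_\<sigma>: "j \<in> \<sigma> x \<longleftrightarrow> low n x \<and> 0 < x j" if "j \<in> {1..n}" for j x
    using that by (auto simp: \<sigma>_def pos_def)
  show ?thesis
  proof (rule Cn_realizableI[OF n, where d = "n + 2" and \<sigma> = \<sigma> and \<tau> = \<tau>])
    show "allowed n (\<sigma> x) (\<tau> x)" for x by (rule al)
    show "\<exists>x\<in>coord_space (n + 2). \<sigma> x = s \<and> \<tau> x = t" if "allowed n s t" for s t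
      using n that
    proof (rule allowed_obtain_petals)
      fix b P assume P: "P \<subseteq> ?I" "b \<Longrightarrow> P \<noteq> ?I"
        "s = (if b then P \<inter> {1..n} else {})" "t = petals ?I P"
      obtain x where "x \<in> coord_space (n + 2)" "pos ?I x = P" "low n x \<longleftrightarrow> b"
        using low_pos_point[OF P(1,2)] by blast
      then show ?thesis using P(3,4) by (intro bexI[of _ x]) (simp_all add: \<sigma>_def \<tau>_def)
    qed
    show "convex_open_pred (n + 2) (\<lambda>x. j \<in> \<sigma> x)" if "j \<in> {1..n}" for j
      unfolding mem_\<sigma>[OF that] by (intro convex_open_pred_conj convex_open_pred_low convex_open_pred_pos)
    then show "convex_open_pred (n + 2) (\<lambda>x. n + 1 \<in> word n (\<sigma> x) (\<tau> x) \<and> j \<in> \<sigma> x)"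
      if "j \<in> {1..n}" for j
      by (rule convex_open_pred_cong[rotated]) (use that w in auto)
    show \<tau>: "convex_open_pred (n + 2) (\<lambda>x. k \<in> \<tau> x)" if "k \<in> ?I" for k
      unfolding \<tau>_def by (rule convex_open_pred_petals) (use that in auto)
    show "convex_open_pred (n + 2) (\<lambda>x. n + 1 \<in> word n (\<sigma> x) (\<tau> x) \<and> k \<in> \<tau> x)" if k: "k \<in> ?I" for k
    proof (rule convex_open_pred_cong[OF _ convex_open_pred_conj[OF convex_open_pred_low \<tau>[OF k]]])
      fix x
      have "\<sigma> x \<noteq> {}" if h: "low n x" "k \<in> \<tau> x"
      proof -
        obtain j where j: "j \<in> {1..n}" "j \<noteq> k" using exists_other_index[OF n] by blast
        then have "j \<in> \<sigma> x" using h(2) unfolding mem_\<sigma>[OF j(1)] \<tau>_def mem_petals_pos[OF k]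
          using h(1) by auto
        then show ?thesis by blast
      qed
      moreover have "low n x" if "\<sigma> x \<noteq> {}" using that by (auto simp: \<sigma>_def split: if_splits)
      ultimately show "low n x \<and> k \<in> \<tau> x \<longleftrightarrow> n + 1 \<in> word n (\<sigma> x) (\<tau> x) \<and> k \<in> \<tau> x"
        unfolding w by blast
    qed
  qed auto
qed

text \<open>The region where \<open>low n x\<close> holds but all of the first \<open>n\<close> coordinates are \<open>\<le> 0\<close>
  is added to the \<open>m\<close>-th set, whose convexity is not required.\<close>

lemma Cn_realizable_without_facet:
  assumes n: "n \<ge> 2" and m: "m \<in> {1..n}"
  shows "realizable_without (2 * n + 2) (code_Cn n) m"
proof -
  let ?I = "{1..n + 1}"
  define \<sigma> where "\<sigma> x = (if low n x then
      if pos ?I x \<inter> {1..n} = {} then {m} else pos ?I x \<inter> {1..n} else {})" for x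
  define \<tau> where "\<tau> x = petals ?I (pos ?I x)" for x
  have mem_\<tau>: "0 < x l" if "k \<in> \<tau> x" "l \<in> ?I" "l \<noteq> k" for k l x
    using that by (auto simp: \<tau>_def petals_def pos_def)
  \<comment> \<open>Petals miss the added region, so it does not enter the pairs of \<open>m\<close>
    with a petal.\<close>
  have \<tau>_pos: "pos ?I x \<inter> {1..n} \<noteq> {}" if "k \<in> \<tau> x" for k x
  proof -
    obtain j where j: "j \<in> {1..n}" "j \<noteq> k" using exists_other_index[OF n] by blast
    then have "j \<in> pos ?I x \<inter> {1..n}" using mem_\<tau>[OF that, of j] by (auto simp: pos_def)
    then show ?thesis by blast
  qed
  have al: "allowed n (\<sigma> x) (\<tau> x)" for x
  proof (cases "low n x \<and> pos ?I x \<inter> {1..n} = {}")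
    case True
    then have "\<tau> x = {}" using \<tau>_pos by blast
    moreover have "\<sigma> x = {m}" using True by (simp add: \<sigma>_def)
    moreover have "{m} \<subset> {1..n}" using m exists_other_index[OF n, of m] by auto
    ultimately show ?thesis by (simp add: allowed_def)
  next
    case False
    then have "\<sigma> x = (if low n x then pos ?I x \<inter> {1..n} else {})" by (auto simp: \<sigma>_def)
    then show ?thesis
      unfolding \<tau>_def using low_pos by (simp only:) (intro allowed_petals[OF n]; auto simp: pos_def)
  qed
  have w: "m \<in> word n (\<sigma> x) (\<tau> x) \<longleftrightarrow> m \<in> \<sigma> x" for x
    using allowed_subset[OF al[of x]] m by (intro word_iff) auto
  have mem_pos: "j \<in> pos ?I x \<inter> {1..n} \<longleftrightarrow> 0 < x j" if "j \<in> {1..n}" for j x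
    using that by (simp add: pos_def)
  have mem_\<sigma>: "j \<in> \<sigma> x \<longleftrightarrow> low n x \<and> 0 < x j" if "j \<in> {1..n}" "j \<noteq> m" for j x
    using mem_pos[OF that(1), of x] that(2) unfolding \<sigma>_def by auto
  have mem_m: "m \<in> \<sigma> x \<longleftrightarrow> low n x \<and> (0 < x m \<or> pos ?I x \<inter> {1..n} = {})" for x
    using mem_pos[OF m, of x] unfolding \<sigma>_def by auto
  show ?thesis
  proof (rule Cn_realizableI[OF n, where d = "n + 2" and \<sigma> = \<sigma> and \<tau> = \<tau>])
    show "allowed n (\<sigma> x) (\<tau> x)" for x by (rule al)
    show "\<exists>x\<in>coord_space (n + 2). \<sigma> x = s \<and> \<tau> x = t" if "allowed n s t" for s t
      using n that
    proof (rule allowed_obtain_petals)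
      fix b P assume P: "P \<subseteq> ?I" "b \<Longrightarrow> P \<noteq> ?I"
        "s = (if b then P \<inter> {1..n} else {})" "t = petals ?I P" "b \<longleftrightarrow> s \<noteq> {}"
      obtain x where "x \<in> coord_space (n + 2)" "pos ?I x = P" "low n x \<longleftrightarrow> b"
        using low_pos_point[OF P(1,2)] by blast
      moreover have "P \<inter> {1..n} \<noteq> {}" if b using P(3,5) that by simp
      ultimately show ?thesis using P(3,4) by (intro bexI[of _ x]) (simp_all add: \<sigma>_def \<tau>_def)
    qed
    show \<sigma>: "convex_open_pred (n + 2) (\<lambda>x. j \<in> \<sigma> x)" if "j \<in> {1..n}" "j \<noteq> m" for j
      unfolding mem_\<sigma>[OF that] by (intro convex_open_pred_conj convex_open_pred_low convex_open_pred_pos)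
    \<comment> \<open>Thanks to the added region the facets fill the whole half-space.\<close>
    show "convex_open_pred (n + 2) (\<lambda>x. \<sigma> x \<noteq> {})"
      by (rule convex_open_pred_cong[OF _ convex_open_pred_low[of _ n]]) (simp add: \<sigma>_def)
    show "convex_open_pred (n + 2) (\<lambda>x. m \<in> word n (\<sigma> x) (\<tau> x) \<and> j \<in> \<sigma> x)"
      if j: "j \<in> {1..n}" "j \<noteq> m" for j
    proof (rule convex_open_pred_cong[OF _ convex_open_pred_conj[OF convex_open_pred_pos[of _ m] \<sigma>[OF j]]])
      fix x
      have "pos ?I x \<inter> {1..n} \<noteq> {}" if "j \<in> \<sigma> x"
        using that mem_pos[OF j(1), of x] unfolding mem_\<sigma>[OF j] by blast
      then show "0 < x m \<and> j \<in> \<sigma> x \<longleftrightarrow> m \<in> word n (\<sigma> x) (\<tau> x) \<and> j \<in> \<sigma> x"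
        unfolding w mem_m mem_\<sigma>[OF j] by blast
    qed
    show \<tau>: "convex_open_pred (n + 2) (\<lambda>x. k \<in> \<tau> x)" if "k \<in> ?I" for k
      unfolding \<tau>_def by (rule convex_open_pred_petals) (use that in auto)
    show "convex_open_pred (n + 2) (\<lambda>x. m \<in> word n (\<sigma> x) (\<tau> x) \<and> k \<in> \<tau> x)" if k: "k \<in> ?I" for k
      by (rule convex_open_pred_cong[OF _ convex_open_pred_conj[OF convex_open_pred_low[of _ n]
              convex_open_pred_conj[OF convex_open_pred_pos[of _ m] \<tau>[OF k]]]])
        (use \<tau>_pos in \<open>auto simp: w mem_m\<close>)
  qed (use m in auto)
qed

section \<open>Realizations exempting a petal\<close>

lemma sum_one_exception:
  fixes a b :: real and i n :: nat
  assumes "i \<in> {1..n}"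
  shows "(\<Sum>k\<in>{1..n}. if k = i then a else b) = a + real (n - 1) * b"
proof -
  have "(\<Sum>k\<in>{1..n}. if k = i then a else b) = a + (\<Sum>k\<in>{1..n} - {i}. if k = i then a else b)"
    using assms by (subst sum.remove[of _ i]) auto
  also have "(\<Sum>k\<in>{1..n} - {i}. if k = i then a else b) = (\<Sum>k\<in>{1..n} - {i}. b)"
    by (rule sum.cong) auto
  also have "\<dots> = real (n - 1) * b" using assms by simp
  finally show ?thesis .
qed

lemma sum_on_subset:
  fixes c :: real and n :: nat
  assumes "s \<subseteq> {1..n}"
  shows "(\<Sum>k\<in>{1..n}. if k \<in> s then c else 0) = real (card s) * c"
proof -
  have "(\<Sum>k\<in>{1..n}. if k \<in> s then c else 0) = (\<Sum>k\<in>{1..n} \<inter> s. c)"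
    by (rule sum.inter_restrict[symmetric]) simp
  also have "{1..n} \<inter> s = s" using assms by blast
  finally show ?thesis by simp
qed

lemma pos_eq_empty: "(\<Sum>k\<in>I. x k) > 0 \<Longrightarrow> pos I x \<noteq> {}"
proof
  assume s: "(\<Sum>k\<in>I. x k) > 0" and "pos I x = {}"
  then have "x k \<le> 0" if "k \<in> I" for k using that by (force simp: pos_def)
  then have "(\<Sum>k\<in>I. x k) \<le> 0" by (rule sum_nonpos)
  then show False using s by simp
qed

text \<open>In \<open>slab\<close> the coordinate sum is positive, so some coordinate is, and the
  facets cover \<open>slab\<close>. Petals i \<le> n use the threshold 1: at the center the sum
  exceeds n - 1, outside \<open>slab\<close>, and in petal i within \<open>slab\<close> the bound n
  - 1 forces x i \<le> 0, which gives exactly {1..n} - {i}. The exempt petal consists of the center,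
  the region where all facets meet, and \<open>neg\<close>, which supplies the word with this petal
  alone. Its intersection with any other set keeps one convex piece.\<close>

lemma Cn_realizable_without_center_petal:
  assumes n: "n \<ge> 2"
  shows "realizable_without (2 * n + 2) (code_Cn n) (n + 1 + (n + 1))"
proof -
  let ?J = "{1..n}"
  define slab where "slab x \<longleftrightarrow> 0 < (\<Sum>k\<in>?J. x k) \<and> (\<Sum>k\<in>?J. x k) < real (n - 1)"
    for x :: "nat \<Rightarrow> real"
  define Q where "Q x = {k \<in> ?J. 1 < x k}" for x :: "nat \<Rightarrow> real"
  define neg where "neg x \<longleftrightarrow> (\<forall>k\<in>?J. x k < 0)" for x :: "nat \<Rightarrow> real"
  define \<sigma> where "\<sigma> x = (if slab x then pos ?J x else {})" for x
  define \<tau> where "\<tau> x = petals ?J (Q x) \<union> (if Q x = ?J \<or> \<sigma> x = ?J \<or> neg x then {n + 1} else {})" for x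
  have J: "?J \<noteq> {}" "n + 1 \<notin> ?J" and I: "insert (n + 1) ?J = {1..n + 1}" using n by auto
  have Q_full: "\<not> slab x" if "Q x = ?J" for x
  proof -
    have "1 \<le> x k" if "k \<in> ?J" for k
    proof -
      have "k \<in> Q x" using that \<open>Q x = ?J\<close> by blast
      then show ?thesis by (simp add: Q_def)
    qed
    then have "(\<Sum>k\<in>?J. 1) \<le> (\<Sum>k\<in>?J. x k)" by (intro sum_mono) auto
    then show ?thesis using n by (simp add: slab_def)
  qed
  have Q_petal: "x i \<le> 0" if "i \<in> ?J" "?J - {i} \<subseteq> Q x" "slab x" for i x
  proof -
    have "(\<Sum>k\<in>?J - {i}. 1) \<le> (\<Sum>k\<in>?J - {i}. x k)"
    proof (rule sum_mono)
      fix k assume "k \<in> ?J - {i}"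
      then have "k \<in> Q x" using that(2) by blast
      then show "1 \<le> x k" by (simp add: Q_def)
    qed
    moreover have "(\<Sum>k\<in>?J. x k) = x i + (\<Sum>k\<in>?J - {i}. x k)"
      using that(1) by (intro sum.remove) auto
    ultimately show ?thesis using that(1,3) by (simp add: slab_def)
  qed
  have neg_pos: "\<not> slab x" "Q x = {}" if "neg x" for x
  proof -
    have "x k \<le> 0" if "k \<in> ?J" for k using that \<open>neg x\<close> by (force simp: neg_def)
    then have "(\<Sum>k\<in>?J. x k) \<le> 0" by (rule sum_nonpos)
    then show "\<not> slab x" by (simp add: slab_def)
    show "Q x = {}" using that by (force simp: Q_def neg_def)
  qed
  have slab_pos: "\<sigma> x \<noteq> {} \<longleftrightarrow> slab x" for x
    using pos_eq_empty[of x ?J] by (simp add: \<sigma>_def slab_def)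
  have \<sigma>_sub: "\<sigma> x \<subseteq> ?J" for x by (auto simp: \<sigma>_def pos_def)
  have mem_\<sigma>: "j \<in> \<sigma> x \<longleftrightarrow> slab x \<and> 0 < x j" if "j \<in> ?J" for j x
    using that by (simp add: \<sigma>_def pos_def)
  have mem_\<tau>: "k \<in> \<tau> x \<longleftrightarrow> (\<forall>l\<in>?J - {k}. 1 < x l)" if k: "k \<in> ?J" for k x
  proof -
    have "k \<noteq> n + 1" using k by auto
    then have "k \<in> \<tau> x \<longleftrightarrow> k \<in> petals ?J (Q x)" unfolding \<tau>_def by simp
    also have "\<dots> \<longleftrightarrow> (\<forall>l\<in>?J - {k}. 1 < x l)" using k unfolding petals_def Q_def by blast
    finally show ?thesis .
  qed
  have mem_\<tau>_last: "n + 1 \<in> \<tau> x \<longleftrightarrow> Q x = ?J \<or> \<sigma> x = ?J \<or> neg x" for x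
    unfolding \<tau>_def petals_def using J(2) by simp
  have al: "allowed n (\<sigma> x) (\<tau> x)" for x
  proof -
    have "Q x \<subseteq> ?J" by (auto simp: Q_def)
    then show ?thesis
    proof (cases rule: petals_cases)
      case 1
      then have "\<sigma> x = {}" using Q_full by (simp add: \<sigma>_def)
      moreover have "\<tau> x = {1..n + 1}" unfolding \<tau>_def 1(2) using 1(1) I by auto
      ultimately show ?thesis by (simp add: allowed_def)
    next
      case (2 i)
      obtain j where j: "j \<in> ?J" "j \<noteq> i" using exists_other_index[OF n] by blast
      have "Q x \<noteq> {}" "Q x \<noteq> ?J" using j 2(1,2) by blast+
      then have nn: "\<not> neg x" using neg_pos by blast
      show ?thesis
      proof (cases "slab x")
        case True
        have "\<sigma> x = ?J - {i}"
        proof (rule set_eqI)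
          fix k
          have "x i \<le> 0" using Q_petal[OF 2(1) _ True] 2(2) by simp
          moreover have "1 < x k" if "k \<in> ?J" "k \<noteq> i"
          proof -
            have "k \<in> Q x" using 2(2) that by blast
            then show ?thesis by (simp add: Q_def)
          qed
          ultimately show "k \<in> \<sigma> x \<longleftrightarrow> k \<in> ?J - {i}"
            using True unfolding \<sigma>_def pos_def by force
        qed
        moreover from this have "\<sigma> x \<noteq> ?J" using 2(1) by blast
        then have "\<tau> x = {i}" unfolding \<tau>_def 2(3) using nn \<open>Q x \<noteq> ?J\<close> by simp
        ultimately show ?thesis using 2(1) unfolding allowed_def by blast
      next
        case False
        then have "\<sigma> x = {}" by (simp add: \<sigma>_def)
        moreover from this have "\<tau> x = {i}" unfolding \<tau>_def 2(3) using nn \<open>Q x \<noteq> ?J\<close> J by simp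
        ultimately show ?thesis using 2(1) unfolding allowed_def by auto
      qed
    next
      case 3
      show ?thesis
      proof (cases "slab x")
        case True
        then have nn: "\<not> neg x" "\<sigma> x \<noteq> {}" using neg_pos slab_pos by blast+
        then have "\<tau> x = (if \<sigma> x = ?J then {n + 1} else {})" unfolding \<tau>_def 3(3) using 3(1) by simp
        then show ?thesis using nn(2) \<sigma>_sub[of x] unfolding allowed_def by (auto split: if_splits)
      next
        case False
        then have s: "\<sigma> x = {}" by (simp add: \<sigma>_def)
        then have "\<tau> x = (if neg x then {n + 1} else {})" unfolding \<tau>_def 3(3) using 3(1) J by simp
        then show ?thesis using s unfolding allowed_def by (auto split: if_splits)
      qed
    qed
  qed
  \<comment> \<open>Reduces realizing a word to arithmetic with the coordinates \<open>a\<close>,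
    cut off outside {1..n}.\<close>
  have point: "\<exists>x\<in>coord_space (n + 1). \<sigma> x = s \<and> \<tau> x = t"
    if s: "s = (if 0 < (\<Sum>k\<in>?J. a k) \<and> (\<Sum>k\<in>?J. a k) < real (n - 1) then {k \<in> ?J. 0 < a k} else {})"
      and B: "B = {k \<in> ?J. 1 < a k}"
      and t: "t = petals ?J B \<union> (if B = ?J \<or> s = ?J \<or> (\<forall>k\<in>?J. a k < 0) then {n + 1} else {})"
    for s t B and a :: "nat \<Rightarrow> real"
  proof -
    define x where "x k = (if k \<in> ?J then a k else 0)" for k
    have x: "x k = a k" if "k \<in> ?J" for k using that by (simp add: x_def)
    have "(\<Sum>k\<in>?J. x k) = (\<Sum>k\<in>?J. a k)" by (rule sum.cong) (simp_all add: x)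
    moreover have "pos ?J x = {k \<in> ?J. 0 < a k}" using x by (auto simp: pos_def)
    ultimately have \<sigma>: "\<sigma> x = s" unfolding \<sigma>_def slab_def s by simp
    have "Q x = B" unfolding Q_def B using x by auto
    moreover have "neg x \<longleftrightarrow> (\<forall>k\<in>?J. a k < 0)" unfolding neg_def using x by auto
    ultimately have "\<tau> x = t" unfolding \<tau>_def t \<sigma> by simp
    moreover have "x \<in> coord_space (n + 1)" by (auto simp: topspace_Euclidean_space x_def)
    ultimately show ?thesis using \<sigma> by blast
  qed
  have none: "petals ?J {} = {}" by (rule petals_none[of 1 _ 2]) (use n in auto)
  have realized: "\<exists>x\<in>coord_space (n + 1). \<sigma> x = s \<and> \<tau> x = t" if "allowed n s t" for s t
  proof -
    from that consider "s = {}" "t = {}" | i where "s = {}" "i \<in> ?J" "t = {i}"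
      | "s = {}" "t = {n + 1}" | "s = {}" "t = {1..n + 1}"
      | "s \<noteq> {}" "s \<subset> ?J" "t = {}" | i where "i \<in> ?J" "s = ?J - {i}" "t = {i}"
      | "s = ?J" "t = {n + 1}"
      unfolding allowed_def I[symmetric] by blast
    then show ?thesis
    proof cases
      case 1
      show ?thesis by (rule point[of _ "\<lambda>k. 0" "{}"]) (use n 1 none in auto)
    next
      case (2 i)
      obtain j where j: "j \<in> ?J" "j \<noteq> i" using exists_other_index[OF n] by blast
      show ?thesis
      \<comment> \<open>The sum 2 (n - 1) lies beyond \<open>slab\<close>.\<close>
      proof (rule point[of _ "\<lambda>k. if k = i then 0 else 2" "?J - {i}"])
        have "(\<Sum>k\<in>?J. if k = i then 0 else 2) = 0 + real (n - 1) * 2"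
          by (rule sum_one_exception[OF 2(2)])
        then show "s = (if 0 < (\<Sum>k\<in>?J. if k = i then 0 else 2) \<and>
            (\<Sum>k\<in>?J. if k = i then 0 else 2) < real (n - 1)
          then {k \<in> ?J. 0 < (if k = i then 0 else (2::real))} else {})"
          using 2(1) by simp
        show "?J - {i} = {k \<in> ?J. 1 < (if k = i then 0 else (2::real))}" by auto
        have "?J - {i} \<noteq> ?J" using 2(2) by blast
        moreover have "s \<noteq> ?J" unfolding 2(1) using J by simp
        moreover have "\<not> (if j = i then 0 else (2::real)) < 0" using j(2) by simp
        then have "\<not> (\<forall>k\<in>?J. (if k = i then 0 else (2::real)) < 0)" using j(1) by blast
        ultimately show "t = petals ?J (?J - {i}) \<union> (if ?J - {i} = ?J \<or> s = ?J \<or>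
            (\<forall>k\<in>?J. (if k = i then 0 else (2::real)) < 0) then {n + 1} else {})"
          unfolding petals_one[OF 2(2)] 2(3) by (simp only: simp_thms if_False Un_empty_right)
      qed
    next
      case 3
      show ?thesis by (rule point[of _ "\<lambda>k. -1" "{}"]) (use 3 none in simp_all)
    next
      case 4
      show ?thesis
      proof (rule point[of _ "\<lambda>k. 2" ?J])
        show "t = petals ?J ?J \<union> (if ?J = ?J \<or> s = ?J \<or> (\<forall>k\<in>?J. (2::real) < 0) then {n + 1} else {})"
          unfolding petals_all 4(2) I[symmetric] by simp
        have "\<not> (\<Sum>k\<in>?J. 2) < real (n - 1)" by simp
        then show "s = (if 0 < (\<Sum>k\<in>?J. 2) \<and> (\<Sum>k\<in>?J. 2) < real (n - 1)
          then {k \<in> ?J. 0 < (2::real)} else {})"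
          unfolding 4(1) by presburger
      qed auto
    next
      case 5
      then have fin: "finite s" using finite_subset[of s ?J] by blast
      have c: "1 \<le> card s" "card s < n"
        using 5 psubset_card_mono[of ?J s] fin by (auto simp: Suc_le_eq card_gt_0_iff)
      \<comment> \<open>The value 1/4 is positive, below the threshold 1, and small enough to keep
        the sum below n - 1.\<close>
      define a :: "nat \<Rightarrow> real" where "a k = (if k \<in> s then 1/4 else 0)" for k
      have sum_a: "(\<Sum>k\<in>?J. a k) = real (card s) * (1/4)"
        unfolding a_def by (rule sum_on_subset) (use 5 in blast)
      have a_pos: "{k \<in> ?J. 0 < a k} = s" using 5(2) by (auto simp: a_def)
      have "0 < (\<Sum>k\<in>?J. a k)" "(\<Sum>k\<in>?J. a k) < real (n - 1)" unfolding sum_a using c by auto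
      moreover have "1 < a k \<longleftrightarrow> False" "a k < 0 \<longleftrightarrow> False" for k by (auto simp: a_def)
      ultimately show ?thesis
        by (intro point[of _ a "{}"]) (use a_pos none 5 J in auto)
    next
      case (6 i)
      obtain j where j: "j \<in> ?J" "j \<noteq> i" using exists_other_index[OF n] by blast
      \<comment> \<open>The exceptional coordinate puts the sum at (n - 1) / 2, the middle of
        \<open>slab\<close>.\<close>
      define a :: "nat \<Rightarrow> real" where "a k = (if k = i then - real (n - 1) * 3 / 2 else 2)" for k
      show ?thesis
      proof (rule point[of _ a "?J - {i}"])
        have "(\<Sum>k\<in>?J. a k) = - real (n - 1) * 3 / 2 + real (n - 1) * 2"
          unfolding a_def by (rule sum_one_exception[OF 6(1)])
        then have "0 < (\<Sum>k\<in>?J. a k)" "(\<Sum>k\<in>?J. a k) < real (n - 1)" using n by linarith+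
        moreover have "{k \<in> ?J. 0 < a k} = ?J - {i}" using n by (auto simp: a_def)
        ultimately show "s = (if 0 < (\<Sum>k\<in>?J. a k) \<and> (\<Sum>k\<in>?J. a k) < real (n - 1)
          then {k \<in> ?J. 0 < a k} else {})"
          unfolding 6(2) by (simp only: simp_thms if_True)
        show "?J - {i} = {k \<in> ?J. 1 < a k}" using n by (auto simp: a_def)
        have "?J - {i} \<noteq> ?J" using 6(1) by blast
        moreover have "\<not> a j < 0" using j by (simp add: a_def)
        ultimately show "t = petals ?J (?J - {i}) \<union>
            (if ?J - {i} = ?J \<or> s = ?J \<or> (\<forall>k\<in>?J. a k < 0) then {n + 1} else {})"
          unfolding petals_one[OF 6(1)] 6(2,3) using j(1) by auto
      qed
    next
      case 7
      define a :: "nat \<Rightarrow> real" where "a k = 1/4" for k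
      have "0 < (\<Sum>k\<in>?J. a k)" "(\<Sum>k\<in>?J. a k) < real (n - 1)"
        using n by (auto simp: a_def of_nat_diff)
      moreover have "1 < a k \<longleftrightarrow> False" "a k < 0 \<longleftrightarrow> False" "0 < a k \<longleftrightarrow> True" for k
        by (auto simp: a_def)
      ultimately show ?thesis
        by (intro point[of _ a "{}"]) (use none 7 in auto)
    qed
  qed
  have cop_slab: "convex_open_pred (n + 1) slab"
    unfolding slab_def by (intro convex_open_pred_intros)
  have w: "n + 1 + (n + 1) \<in> word n (\<sigma> x) (\<tau> x) \<longleftrightarrow> n + 1 \<in> \<tau> x" for x
    using allowed_subset[OF al[of x]] by (intro word_iff(3)) auto
  have cop_\<tau>: "convex_open_pred (n + 1) (\<lambda>x. k \<in> \<tau> x)" if "k \<in> ?J" for k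
    unfolding mem_\<tau>[OF that] by (intro convex_open_pred_intros)
  have cop_center: "convex_open_pred (n + 1) (\<lambda>x. slab x \<and> (\<forall>k\<in>?J. 0 < x k))"
    by (intro convex_open_pred_conj cop_slab convex_open_pred_intros)
  have center: "slab x \<and> (\<forall>k\<in>?J. 0 < x k) \<longleftrightarrow> \<sigma> x = ?J" for x
    using J(1) unfolding \<sigma>_def pos_def by auto
  have cop_W: "convex_open_pred (n + 1) (\<lambda>x. \<forall>k\<in>?J. 1 < x k)"
    by (intro convex_open_pred_intros)
  have pair_\<sigma>: "n + 1 \<in> \<tau> x \<and> slab x \<longleftrightarrow> \<sigma> x = ?J" for x
    unfolding mem_\<tau>_last using Q_full neg_pos slab_pos[of x] J(1) by blast
  show ?thesis
  proof (rule Cn_realizableI[OF n, where d = "n + 1" and \<sigma> = \<sigma> and \<tau> = \<tau>])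
    show "allowed n (\<sigma> x) (\<tau> x)" for x by (rule al)
    show "\<exists>x\<in>coord_space (n + 1). \<sigma> x = s \<and> \<tau> x = t" if "allowed n s t" for s t
      by (rule realized[OF that])
    show "convex_open_pred (n + 1) (\<lambda>x. j \<in> \<sigma> x)" if "j \<in> ?J" for j
      unfolding mem_\<sigma>[OF that] by (intro convex_open_pred_conj cop_slab convex_open_pred_pos)
    show "convex_open_pred (n + 1) (\<lambda>x. \<sigma> x \<noteq> {})"
      unfolding slab_pos by (rule cop_slab)
    show "convex_open_pred (n + 1) (\<lambda>x. k \<in> \<tau> x)"
      if "k \<in> {1..n + 1}" "n + 1 + k \<noteq> n + 1 + (n + 1)" for k
      by (rule cop_\<tau>) (use that in auto)
    show "convex_open_pred (n + 1) (\<lambda>x. n + 1 + (n + 1) \<in> word n (\<sigma> x) (\<tau> x) \<and> j \<in> \<sigma> x)"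
      if j: "j \<in> ?J" for j
    proof (rule convex_open_pred_cong[OF _ cop_center])
      fix x show "slab x \<and> (\<forall>k\<in>?J. 0 < x k) \<longleftrightarrow>
          n + 1 + (n + 1) \<in> word n (\<sigma> x) (\<tau> x) \<and> j \<in> \<sigma> x"
        unfolding w center using pair_\<sigma>[of x] mem_\<sigma>[OF j, of x] j by blast
    qed
    show "convex_open_pred (n + 1) (\<lambda>x. n + 1 + (n + 1) \<in> word n (\<sigma> x) (\<tau> x) \<and> \<sigma> x \<noteq> {})"
      by (rule convex_open_pred_cong[OF _ cop_center]) (simp only: w center slab_pos pair_\<sigma>)
    show "convex_open_pred (n + 1) (\<lambda>x. n + 1 + (n + 1) \<in> word n (\<sigma> x) (\<tau> x) \<and> k \<in> \<tau> x)"
      if "k \<in> {1..n + 1}" "n + 1 + k \<noteq> n + 1 + (n + 1)" for k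
    proof (rule convex_open_pred_cong[OF _ cop_W])
      fix x
      have k: "k \<in> ?J" "k \<noteq> n + 1" using that by auto
      have "\<tau> x = {1..n + 1}" if "n + 1 \<in> \<tau> x" "k \<in> \<tau> x"
        using allowed_two_petals[OF al that] k(2) by blast
      moreover have "Q x = ?J" if full: "\<tau> x = {1..n + 1}"
      proof -
        obtain j where j: "j \<in> ?J" "j \<noteq> k" using exists_other_index[OF n] by blast
        have "k \<in> \<tau> x" "j \<in> \<tau> x" using full k(1) j(1) by auto
        then show ?thesis unfolding mem_\<tau>[OF k(1)] mem_\<tau>[OF j(1)] Q_def using j(2) by blast
      qed
      moreover have "n + 1 \<in> \<tau> x \<and> k \<in> \<tau> x" if "Q x = ?J"
        unfolding mem_\<tau>_last mem_\<tau>[OF k(1)] using that unfolding Q_def by blast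
      moreover have "(\<forall>k\<in>?J. 1 < x k) \<longleftrightarrow> Q x = ?J" unfolding Q_def by blast
      ultimately show "(\<forall>k\<in>?J. 1 < x k) \<longleftrightarrow>
          n + 1 + (n + 1) \<in> word n (\<sigma> x) (\<tau> x) \<and> k \<in> \<tau> x"
        unfolding w by blast
    qed
  qed
qed

text \<open>The inequalities are \<open>0 < x k\<close> for k \<le> n, and \<open>up\<close> as the
  last one. If all of them except possibly the m-th hold, then x (n + 1) > 0, so the center avoids
  \<open>slab\<close>. Leaving x m out of the sum in \<open>up\<close> lets the petals i \<le> n
  other than m reach into \<open>slab\<close>: a large x m makes the total positive although the
  remaining sum is below x (n + 1) < 0. The region of the m-th pattern itself stays outside
  \<open>slab\<close>, so petal m is made instead of the center, of \<open>bud\<close> inside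
  \<open>slab\<close>, and of \<open>neg\<close>.\<close>

lemma Cn_realizable_without_petal:
  assumes n: "n \<ge> 2" and m: "m \<in> {1..n}"
  shows "realizable_without (2 * n + 2) (code_Cn n) (n + 1 + m)"
proof -
  let ?J = "{1..n}" and ?I = "{1..n + 1}"
  define slab where "slab x \<longleftrightarrow> 0 < (\<Sum>k\<in>?J. x k) \<and> x (n + 1) < 0" for x :: "nat \<Rightarrow> real"
  define up where "up x \<longleftrightarrow> (\<Sum>k\<in>?J - {m}. x k) < x (n + 1)" for x :: "nat \<Rightarrow> real"
  define neg where "neg x \<longleftrightarrow> (\<forall>k\<in>?J. x k < 0)" for x :: "nat \<Rightarrow> real"
  define P where "P x = pos ?J x \<union> (if up x then {n + 1} else {})" for x
  define \<sigma> where "\<sigma> x = (if slab x then pos ?J x else {})" for x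
  \<comment> \<open>Strict \<open>x m < 0\<close> keeps this piece open; with x m = 0 the same
    facets occur without a petal.\<close>
  define bud where "bud x \<longleftrightarrow> slab x \<and> ?J - {m} \<subseteq> pos ?J x \<and> x m < 0" for x
  define \<tau> where "\<tau> x = (petals ?I (P x) - {m}) \<union> (if P x = ?I \<or> bud x \<or> neg x then {m} else {})" for x
  have J: "?J \<noteq> {}" "n + 1 \<notin> ?J" and I: "insert (n + 1) ?J = ?I" and mI: "m \<in> ?I"
    and m_last: "m \<noteq> n + 1"
    using n m by auto
  have pos_J: "pos ?J x \<subseteq> ?J" for x by (auto simp: pos_def)
  have P_sub: "P x \<subseteq> ?I" for x unfolding P_def I[symmetric] using pos_J by auto
  have P_J: "P x \<inter> ?J = pos ?J x" for x unfolding P_def using pos_J[of x] J(2) by auto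
  have P_last: "n + 1 \<in> P x \<longleftrightarrow> up x" for x unfolding P_def using pos_J[of x] J(2) by auto
  have up_slab: "\<not> slab x" if "?J - {m} \<subseteq> P x" "n + 1 \<in> P x" for x
  proof -
    have "0 \<le> (\<Sum>k\<in>?J - {m}. x k)"
    proof (rule sum_nonneg)
      fix k assume k: "k \<in> ?J - {m}"
      then have "k \<in> pos ?J x" using that(1) P_J[of x] by blast
      then show "0 \<le> x k" by (simp add: pos_def)
    qed
    then show ?thesis using that(2) unfolding P_last up_def slab_def by simp
  qed
  have neg_pos: "\<not> slab x" "pos ?J x = {}" if "neg x" for x
  proof -
    have "x k \<le> 0" if "k \<in> ?J" for k using that \<open>neg x\<close> by (force simp: neg_def)
    then have "(\<Sum>k\<in>?J. x k) \<le> 0" by (rule sum_nonpos)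
    then show "\<not> slab x" by (simp add: slab_def)
    show "pos ?J x = {}" using that by (force simp: pos_def neg_def)
  qed
  have slab_pos: "\<sigma> x \<noteq> {} \<longleftrightarrow> slab x" for x
    using pos_eq_empty[of x ?J] by (simp add: \<sigma>_def slab_def)
  have mem_\<sigma>: "j \<in> \<sigma> x \<longleftrightarrow> slab x \<and> 0 < x j" if "j \<in> ?J" for j x
    using that by (simp add: \<sigma>_def pos_def)
  have mem_\<tau>: "k \<in> \<tau> x \<longleftrightarrow> ?I - {k} \<subseteq> P x" if "k \<in> ?I" "k \<noteq> m" for k x
    using that by (simp add: \<tau>_def petals_def)
  have mem_\<tau>_m: "m \<in> \<tau> x \<longleftrightarrow> P x = ?I \<or> bud x \<or> neg x" for x
    by (simp add: \<tau>_def)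
  have bud_m: "m \<notin> P x" if "bud x" for x
  proof -
    have "m \<notin> pos ?J x" using that by (auto simp: bud_def pos_def)
    then show ?thesis using P_J[of x] m by blast
  qed
  have neg_petals: "\<not> ?I - {k} \<subseteq> P x" if "neg x" for k x
  proof -
    obtain j where j: "j \<in> ?J" "j \<noteq> k" using exists_other_index[OF n] by blast
    have "j \<notin> P x" using neg_pos(2)[OF that] P_J[of x] j(1) by blast
    moreover have "j \<in> ?I" using j(1) I by blast
    ultimately show ?thesis using j(2) by blast
  qed
  have al: "allowed n (\<sigma> x) (\<tau> x)" for x
    using P_sub[of x]
  proof (cases rule: petals_cases)
    case 1
    have "\<not> slab x" by (rule up_slab) (use 1(1) I in blast)+
    then have "\<sigma> x = {}" by (simp add: \<sigma>_def)
    moreover have "?I - {m} \<union> {m} = ?I" using mI by blast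
    then have "\<tau> x = ?I" unfolding \<tau>_def 1(2) using 1(1) by (simp only: simp_thms if_True)
    ultimately show ?thesis by (simp add: allowed_def)
  next
    case (2 i)
    have nn: "\<not> neg x" using neg_petals[of x i] 2(2) by blast
    have ne: "P x \<noteq> ?I" using 2(1,2) by blast
    show ?thesis
    proof (cases "i = m")
      case True
      have "?J - {m} \<subseteq> P x" unfolding 2(2) True using I by blast
      moreover have "n + 1 \<in> P x" unfolding 2(2) True using m_last by simp
      ultimately have "\<not> slab x" by (rule up_slab)
      then have "\<sigma> x = {}" "\<not> bud x" by (simp_all add: \<sigma>_def bud_def)
      moreover from this have "\<tau> x = {}" unfolding \<tau>_def 2(3) True using nn ne by simp
      ultimately show ?thesis by (simp add: allowed_def)
    next
      case False
      then have "m \<in> P x" using mI unfolding 2(2) by blast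
      then have "\<not> bud x" using bud_m by blast
      then have t: "\<tau> x = {i}" unfolding \<tau>_def 2(3) using nn ne False by simp
      show ?thesis
      proof (cases "slab x")
        case True
        have s: "\<sigma> x = (?I - {i}) \<inter> ?J" using True P_J[of x] unfolding \<sigma>_def 2(2) by simp
        show ?thesis
        proof (cases "i = n + 1")
          case True
          have "\<sigma> x = ?J" unfolding s True by auto
          then show ?thesis using t True by (simp add: allowed_def)
        next
          case False
          have "\<sigma> x = ?J - {i}" unfolding s by auto
          moreover have "i \<in> ?J" using False 2(1) by auto
          ultimately show ?thesis using t unfolding allowed_def by blast
        qed
      next
        case False
        then have "\<sigma> x = {}" by (simp add: \<sigma>_def)
        then show ?thesis using t 2(1) unfolding allowed_def by blast
      qed
    qed
  next
    case 3
    show ?thesis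
    proof (cases "slab x")
      case True
      then have nn: "\<not> neg x" "\<sigma> x \<noteq> {}" using neg_pos slab_pos by blast+
      have s: "\<sigma> x = P x \<inter> ?J" using True P_J[of x] by (simp add: \<sigma>_def)
      have "\<sigma> x \<noteq> ?J"
      proof
        assume "\<sigma> x = ?J"
        then have "?J \<subseteq> P x" using s by blast
        moreover have "?I - {n + 1} = ?J" by auto
        ultimately have "P x = ?I \<or> P x = ?I - {n + 1}"
          using P_sub[of x] I by (cases "n + 1 \<in> P x") blast+
        then show False using 3(1,2) by auto
      qed
      show ?thesis
      proof (cases "bud x")
        case True
        have "\<sigma> x = ?J - {m}"
          using True bud_m[OF True] s P_J[of x] unfolding bud_def by blast
        moreover have "\<tau> x = {m}" unfolding \<tau>_def 3(3) using True by simp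
        ultimately show ?thesis using m unfolding allowed_def by blast
      next
        case False
        then have "\<tau> x = {}" unfolding \<tau>_def 3(3) using nn 3(1) by simp
        then show ?thesis using nn(2) \<open>\<sigma> x \<noteq> ?J\<close> s unfolding allowed_def by blast
      qed
    next
      case False
      then have s: "\<sigma> x = {}" by (simp add: \<sigma>_def)
      have "\<tau> x = {} \<or> \<tau> x = {m}" unfolding \<tau>_def 3(3) by simp
      then show ?thesis using s mI unfolding allowed_def by blast
    qed
  qed
  \<comment> \<open>Here \<open>h\<close> is coordinate n + 1 of the witness, \<open>A\<close> its
    positive coordinates among the first n, and \<open>B\<close> the inequalities that hold.\<close>
  have point: "\<exists>x\<in>coord_space (n + 2). \<sigma> x = s \<and> \<tau> x = t"
    if s: "s = (if 0 < (\<Sum>k\<in>?J. a k) \<and> h < 0 then A else {})"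
      and A: "A = {k \<in> ?J. 0 < a k}"
      and B: "B = A \<union> (if (\<Sum>k\<in>?J - {m}. a k) < h then {n + 1} else {})"
      and t: "t = (petals ?I B - {m}) \<union> (if B = ?I \<or>
        (0 < (\<Sum>k\<in>?J. a k) \<and> h < 0) \<and> ?J - {m} \<subseteq> A \<and> a m < 0 \<or> (\<forall>k\<in>?J. a k < 0) then {m} else {})"
    for s t A B h and a :: "nat \<Rightarrow> real"
  proof -
    define x where "x k = (if k \<in> ?J then a k else if k = n + 1 then h else 0)" for k
    have x: "x k = a k" if "k \<in> ?J" for k using that by (simp add: x_def)
    have xh: "x (n + 1) = h" by (simp add: x_def)
    have "(\<Sum>k\<in>?J. x k) = (\<Sum>k\<in>?J. a k)" by (rule sum.cong) (simp_all add: x)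
    then have slab: "slab x \<longleftrightarrow> 0 < (\<Sum>k\<in>?J. a k) \<and> h < 0" unfolding slab_def xh by simp
    have "(\<Sum>k\<in>?J - {m}. x k) = (\<Sum>k\<in>?J - {m}. a k)" by (rule sum.cong) (simp_all add: x)
    then have up: "up x \<longleftrightarrow> (\<Sum>k\<in>?J - {m}. a k) < h" unfolding up_def xh by simp
    have pos: "pos ?J x = A" unfolding pos_def A using x by auto
    have \<sigma>: "\<sigma> x = s" unfolding \<sigma>_def slab pos s ..
    have P: "P x = B" unfolding P_def pos up B ..
    have neg: "neg x \<longleftrightarrow> (\<forall>k\<in>?J. a k < 0)" unfolding neg_def using x by auto
    have "\<tau> x = t" unfolding \<tau>_def bud_def P slab pos neg x[OF m] t ..
    moreover have "x \<in> coord_space (n + 2)" by (auto simp: topspace_Euclidean_space x_def)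
    ultimately show ?thesis using \<sigma> by blast
  qed
  have sum_m: "(\<Sum>k\<in>?J - {m}. a k) = (\<Sum>k\<in>?J. a k) - a m" for a :: "nat \<Rightarrow> real"
    using sum.remove[OF _ m, of a] by simp
  have "?I - {n + 1} = ?J" by auto
  with petals_one[of "n + 1" ?I] have petals_J: "petals ?I ?J = {n + 1}" by simp
  have realized: "\<exists>x\<in>coord_space (n + 2). \<sigma> x = s \<and> \<tau> x = t" if "allowed n s t" for s t
  proof -
    have split: "i \<in> ?J \<or> i = n + 1" if "i \<in> ?I" for i using that I by blast
    from that consider "s = {}" "t = {}" | i where "s = {}" "i \<in> ?I" "t = {i}"
      | "s = {}" "t = ?I" | "s \<noteq> {}" "s \<subset> ?J" "t = {}"
      | i where "i \<in> ?J" "s = ?J - {i}" "t = {i}" | "s = ?J" "t = {n + 1}"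
      unfolding allowed_def by blast
    \<comment> \<open>The indices m and n + 1 need witnesses of their own: petal m does not follow
      the pattern, and the last inequality is \<open>up\<close>.\<close>
    then consider "s = {}" "t = {}"
      | i where "s = {}" "i \<in> ?J" "i \<noteq> m" "t = {i}"
      | "s = {}" "t = {m}" | "s = {}" "t = {n + 1}" | "s = {}" "t = ?I"
      | "s \<noteq> {}" "s \<subset> ?J" "t = {}"
      | i where "i \<in> ?J" "i \<noteq> m" "s = ?J - {i}" "t = {i}"
      | "s = ?J - {m}" "t = {m}"
      | "s = ?J" "t = {n + 1}"
    proof cases
      case 1
      then show ?thesis by (rule that(1))
    next
      case (2 i)
      consider "i \<in> ?J" "i \<noteq> m" | "i = m" | "i = n + 1" using split[OF 2(2)] by blast
      then show ?thesis
      proof cases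
        case 1
        then show ?thesis by (rule that(2)[OF 2(1) _ _ 2(3)])
      next
        case c: 2
        show ?thesis by (rule that(3)[OF 2(1) 2(3)[unfolded c]])
      next
        case c: 3
        show ?thesis by (rule that(4)[OF 2(1) 2(3)[unfolded c]])
      qed
    next
      case 3
      then show ?thesis by (rule that(5))
    next
      case 4
      then show ?thesis by (rule that(6))
    next
      case (5 i)
      show ?thesis
      proof (cases "i = m")
        case True
        show ?thesis by (rule that(8)[OF 5(2,3)[unfolded True]])
      next
        case False
        show ?thesis by (rule that(7)[OF 5(1) False 5(2,3)])
      qed
    next
      case 6
      then show ?thesis by (rule that(9))
    qed
    then show ?thesis
    proof cases
      case 1
      have "petals ?I {} = {}" by (rule petals_none[OF mI, of "n + 1"]) (use m_last in auto)
      then show ?thesis by (intro point[of _ "\<lambda>k. 0" 0 "{}" "{}"]) (use 1 m in auto)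
    next
      case (2 i)
      define a :: "nat \<Rightarrow> real" where "a k = (if k = i then 0 else 1)" for k
      have iI: "i \<in> ?I" using 2(2) by auto
      have sum_a: "(\<Sum>k\<in>?J. a k) = 0 + real (n - 1) * 1"
        unfolding a_def by (rule sum_one_exception[OF 2(2)])
      have A: "{k \<in> ?J. 0 < a k} = ?J - {i}" by (auto simp: a_def)
      have up: "(\<Sum>k\<in>?J - {m}. a k) < real n"
        unfolding sum_m sum_a using 2(3) n by (simp add: a_def)
      have B: "(?J - {i}) \<union> {n + 1} = ?I - {i}" using 2(2) I J(2) by blast
      have "\<not> a m < 0" using 2(3) by (simp add: a_def)
      moreover have "?I - {i} \<noteq> ?I" using iI by blast
      ultimately show ?thesis
        by (intro point[of _ a "real n" "?J - {i}" "?I - {i}"])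
          (use 2 m A B up petals_one[OF iI] in auto)
    next
      case 3
      have none: "petals ?I {} = {}" by (rule petals_none[OF mI, of "n + 1"]) (use m_last in auto)
      \<comment> \<open>The sum without x m is -(n - 1), above the height -n, so \<open>up\<close>
        fails.\<close>
      define a :: "nat \<Rightarrow> real" where "a k = -1" for k
      have "\<not> (\<Sum>k\<in>?J - {m}. a k) < - real n"
        unfolding sum_m by (simp add: a_def)
      then show ?thesis
        by (intro point[of _ a "- real n" "{}" "{}"]) (use 3 none in \<open>auto simp: a_def\<close>)
    next
      case 4
      define a :: "nat \<Rightarrow> real" where "a k = 1" for k
      have "\<not> (\<Sum>k\<in>?J - {m}. a k) < 0" unfolding sum_m using m by (simp add: a_def)
      moreover have "petals ?I ?J = {n + 1}"
        by (rule petals_J)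
      moreover have "?J \<noteq> ?I" using J(2) I by blast
      moreover have "\<not> a m < 0" "{k \<in> ?J. 0 < a k} = ?J" by (auto simp: a_def)
      ultimately show ?thesis
        by (intro point[of _ a 0 ?J ?J]) (use 4 m m_last in auto)
    next
      case 5
      define a :: "nat \<Rightarrow> real" where "a k = 1" for k
      have "(\<Sum>k\<in>?J - {m}. a k) < real (n + 1)" unfolding sum_m using m by (simp add: a_def)
      moreover have "?J \<union> {n + 1} = ?I" using I by blast
      moreover have "{k \<in> ?J. 0 < a k} = ?J" by (auto simp: a_def)
      moreover have "?I = (petals ?I ?I - {m}) \<union> {m}" unfolding petals_all using mI by blast
      ultimately show ?thesis
        by (intro point[of _ a "real (n + 1)" ?J ?I]) (use 5 in auto)
    next
      case 6
      then obtain j where j: "j \<in> ?J" "j \<notin> s" by blast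
      have jI: "j \<in> ?I" "j \<noteq> n + 1" using j(1) by auto
      define a :: "nat \<Rightarrow> real" where "a k = (if k \<in> s then 1 else 0)" for k
      have "finite s" using 6(2) finite_subset[of s ?J] by blast
      then have c: "1 \<le> card s" using 6(1) by (auto simp: Suc_le_eq card_gt_0_iff)
      have "(\<Sum>k\<in>?J. a k) = real (card s) * 1"
        unfolding a_def by (rule sum_on_subset) (use 6 in blast)
      then have "0 < (\<Sum>k\<in>?J. a k)" using c by simp
      moreover have "\<not> (\<Sum>k\<in>?J - {m}. a k) < -1"
      proof -
        have "0 \<le> (\<Sum>k\<in>?J - {m}. a k)" by (rule sum_nonneg) (simp add: a_def)
        then show ?thesis by simp
      qed
      moreover have "n + 1 \<notin> s" using 6(2) J(2) by blast
      then have "petals ?I s = {}" using petals_none[OF jI(1) _ jI(2) j(2)] by simp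
      moreover have "s \<noteq> ?I" using jI j by blast
      moreover have "\<not> a k < 0" for k by (simp add: a_def)
      moreover have "s = {k \<in> ?J. 0 < a k}" using 6(2) by (auto simp: a_def)
      ultimately show ?thesis
        by (intro point[of _ a "-1" s s]) (use 6 m in auto)
    next
      case (7 i)
      \<comment> \<open>The second summand raises x m to 2 n: the total becomes 2 n - 2 > 0, while
        the sum without x m is -2 < -1. Each summand deviates from a constant at one index only, so
        both sums are easy.\<close>
      define a :: "nat \<Rightarrow> real" where
        "a k = (if k = i then - real n else 1) + (if k = m then 2 * real n - 1 else 0)" for k
      have iI: "i \<in> ?I" using 7(1) by auto
      have am: "a m = 2 * real n" using 7(2) by (simp add: a_def)
      have "(\<Sum>k\<in>?J. a k) = (- real n + real (n - 1) * 1) + (2 * real n - 1)"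
        unfolding a_def sum.distrib sum_one_exception[OF 7(1)] using m by simp
      then have sum_a: "(\<Sum>k\<in>?J. a k) = 2 * real n - 2" using n by (simp add: of_nat_diff)
      have up: "(\<Sum>k\<in>?J - {m}. a k) < -1" unfolding sum_m sum_a am by simp
      have A: "{k \<in> ?J. 0 < a k} = ?J - {i}" using 7(2) n by (auto simp: a_def)
      have B: "(?J - {i}) \<union> {n + 1} = ?I - {i}" using 7(1) I J(2) by blast
      have "0 < (\<Sum>k\<in>?J. a k)" unfolding sum_a using n by simp
      moreover have "\<not> a m < 0" using am by simp
      moreover have "?I - {i} \<noteq> ?I" using iI by blast
      ultimately show ?thesis
        by (intro point[of _ a "-1" "?J - {i}" "?I - {i}"])
          (use 7 m A B up petals_one[OF iI] in auto)
    next
      case 8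
      \<comment> \<open>With -1/2 the total n - 3/2 stays positive for
        \<open>n \<ge> 2\<close>.\<close>
      define a :: "nat \<Rightarrow> real" where "a k = (if k = m then -1/2 else 1)" for k
      have sum_a: "(\<Sum>k\<in>?J. a k) = -1/2 + real (n - 1) * 1"
        unfolding a_def by (rule sum_one_exception[OF m])
      have A: "{k \<in> ?J. 0 < a k} = ?J - {m}" by (auto simp: a_def)
      have "0 < (\<Sum>k\<in>?J. a k)" "\<not> (\<Sum>k\<in>?J - {m}. a k) < -1" "a m < 0"
        unfolding sum_m sum_a using n by (simp_all add: a_def of_nat_diff)
      moreover have "petals ?I (?J - {m}) = {}"
        by (rule petals_none[OF mI, of "n + 1"]) (use m_last J in auto)
      ultimately show ?thesis
        by (intro point[of _ a "-1" "?J - {m}" "?J - {m}"]) (use 8 A in auto)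
    next
      case 9
      define a :: "nat \<Rightarrow> real" where "a k = 1" for k
      have "\<not> (\<Sum>k\<in>?J - {m}. a k) < -1" unfolding sum_m using m by (simp add: a_def)
      moreover have "0 < (\<Sum>k\<in>?J. a k)" using n by (simp add: a_def)
      moreover have "petals ?I ?J = {n + 1}"
        by (rule petals_J)
      moreover have "?J \<noteq> ?I" using J(2) I by blast
      moreover have "\<not> a m < 0" "{k \<in> ?J. 0 < a k} = ?J" by (auto simp: a_def)
      ultimately show ?thesis
        by (intro point[of _ a "-1" ?J ?J]) (use 9 m m_last in auto)
    qed
  qed
  have cop_slab: "convex_open_pred (n + 2) slab"
    unfolding slab_def by (intro convex_open_pred_intros)
  have cop_up: "convex_open_pred (n + 2) up"
    unfolding up_def by (intro convex_open_pred_intros)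
  have w: "n + 1 + m \<in> word n (\<sigma> x) (\<tau> x) \<longleftrightarrow> m \<in> \<tau> x" for x
    using allowed_subset[OF al[of x]] mI by (intro word_iff(3)) auto
  have mem_P: "l \<in> P x \<longleftrightarrow> 0 < x l" if "l \<in> ?J" for l x
  proof -
    have "l \<in> P x \<longleftrightarrow> l \<in> pos ?J x" using P_J[of x] that by blast
    then show ?thesis using that by (simp add: pos_def)
  qed
  have cop_P: "convex_open_pred (n + 2) (\<lambda>x. l \<in> P x)" if "l \<in> ?I" for l
  proof (cases "l = n + 1")
    case True
    then show ?thesis using cop_up by (simp only: P_last)
  next
    case False
    then have "l \<in> ?J" using that by auto
    then show ?thesis using convex_open_pred_pos by (simp only: mem_P)
  qed
  have cop_\<tau>: "convex_open_pred (n + 2) (\<lambda>x. k \<in> \<tau> x)" if k: "k \<in> ?I" "k \<noteq> m" for k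
    unfolding mem_\<tau>[OF k] subset_iff Ball_def[symmetric]
    by (intro convex_open_pred_ball cop_P) auto
  have bud_iff: "bud x \<longleftrightarrow> slab x \<and> (\<forall>k\<in>?J - {m}. 0 < x k) \<and> x m < 0" for x
    unfolding bud_def pos_def by blast
  have cop_bud: "convex_open_pred (n + 2) bud"
    unfolding bud_iff by (intro convex_open_pred_conj cop_slab convex_open_pred_intros)
  \<comment> \<open>Inside \<open>slab\<close> only one piece of petal m remains, so its pair with a
    facet is \<open>bud\<close> or empty.\<close>
  have m_slab: "m \<in> \<tau> x \<and> slab x \<longleftrightarrow> bud x" for x
  proof -
    have "\<not> slab x" if "P x = ?I" by (rule up_slab) (use that I in blast)+
    then show ?thesis unfolding mem_\<tau>_m using neg_pos(1) bud_def by blast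
  qed
  show ?thesis
  proof (rule Cn_realizableI[OF n, where d = "n + 2" and \<sigma> = \<sigma> and \<tau> = \<tau>])
    show "allowed n (\<sigma> x) (\<tau> x)" for x by (rule al)
    show "\<exists>x\<in>coord_space (n + 2). \<sigma> x = s \<and> \<tau> x = t" if "allowed n s t" for s t
      by (rule realized[OF that])
    show "convex_open_pred (n + 2) (\<lambda>x. j \<in> \<sigma> x)" if "j \<in> ?J" for j
      unfolding mem_\<sigma>[OF that] by (intro convex_open_pred_conj cop_slab convex_open_pred_pos)
    show "convex_open_pred (n + 2) (\<lambda>x. \<sigma> x \<noteq> {})"
      unfolding slab_pos by (rule cop_slab)
    show "convex_open_pred (n + 2) (\<lambda>x. k \<in> \<tau> x)"
      if "k \<in> ?I" "n + 1 + k \<noteq> n + 1 + m" for k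
      by (rule cop_\<tau>) (use that in auto)
    show "convex_open_pred (n + 2) (\<lambda>x. n + 1 + m \<in> word n (\<sigma> x) (\<tau> x) \<and> j \<in> \<sigma> x)"
      if j: "j \<in> ?J" for j
    proof (cases "j = m")
      case True
      have False if "m \<in> \<tau> x" "m \<in> \<sigma> x" for x
      proof -
        have "slab x" "0 < x m" using that(2) unfolding mem_\<sigma>[OF m] by blast+
        then show False using m_slab[of x] that(1) unfolding bud_def by simp
      qed
      then show ?thesis unfolding w True
        by (intro convex_open_pred_cong[OF _ convex_open_pred_False]) blast
    next
      case False
      show ?thesis
      proof (rule convex_open_pred_cong[OF _ cop_bud])
        fix x
        show "bud x \<longleftrightarrow> n + 1 + m \<in> word n (\<sigma> x) (\<tau> x) \<and> j \<in> \<sigma> x"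
          unfolding w mem_\<sigma>[OF j] using m_slab[of x] bud_iff[of x] j False by blast
      qed
    qed
    show "convex_open_pred (n + 2) (\<lambda>x. n + 1 + m \<in> word n (\<sigma> x) (\<tau> x) \<and> \<sigma> x \<noteq> {})"
      unfolding w slab_pos m_slab by (rule cop_bud)
    show "convex_open_pred (n + 2) (\<lambda>x. n + 1 + m \<in> word n (\<sigma> x) (\<tau> x) \<and> k \<in> \<tau> x)"
      if "k \<in> ?I" "n + 1 + k \<noteq> n + 1 + m" for k
    proof -
      have k: "k \<in> ?I" "k \<noteq> m" using that by auto
      have "convex_open_pred (n + 2) (\<lambda>x. \<forall>l\<in>?I. l \<in> P x)"
        by (intro convex_open_pred_ball cop_P) auto
      moreover have "(\<forall>l\<in>?I. l \<in> P x) \<longleftrightarrow> m \<in> \<tau> x \<and> k \<in> \<tau> x" for x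
      proof -
        \<comment> \<open>\<open>neg\<close> violates at least two inequalities and
          \<open>bud\<close> violates the m-th, neither of which petal k tolerates; only the center
          remains.\<close>
        have "P x = ?I" if "m \<in> \<tau> x" "?I - {k} \<subseteq> P x"
          using that neg_petals[of x k] bud_m[of x] mI k(2) unfolding mem_\<tau>_m by blast
        moreover have "(\<forall>l\<in>?I. l \<in> P x) \<longleftrightarrow> P x = ?I" using P_sub[of x] by blast
        ultimately show ?thesis unfolding mem_\<tau>[OF k] using mem_\<tau>_m[of x] by blast
      qed
      ultimately show ?thesis unfolding w by (simp only:)
    qed
  qed
qed

text \<open>A single petal neuron is a word of the code, and at least one of the petals 1 and 2 is
  not neuron \<open>j\<close>.\<close>

lemma Cn_trunks_incomparable:
  assumes n: "n \<ge> 2"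
  shows "\<exists>i\<in>{1..2 * n + 2}. \<not> Tk (code_Cn n) {i} \<subseteq> Tk (code_Cn n) {j}"
proof -
  obtain l where l: "l \<in> {1..n + 1}" "n + 1 + l \<noteq> j"
    using n by (cases "j = n + 2") (auto intro: that[of 2] that[of 1])
  have "allowed n {} {l}" using l(1) by (auto simp: allowed_def)
  then have "word n {} {l} \<in> code_Cn n" unfolding code_Cn_words[OF n] by blast
  then have "{n + 1 + l} \<in> code_Cn n" by (simp add: word_def)
  then have "\<not> Tk (code_Cn n) {n + 1 + l} \<subseteq> Tk (code_Cn n) {j}"
    using l(2) by (auto simp: Tk_def)
  moreover have "n + 1 + l \<in> {1..2 * n + 2}" using l(1) by auto
  ultimately show ?thesis by blast
qed

theorem theorem4p9:
  fixes n :: nat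
  assumes "n \<ge> 2"
  shows "minimally_nonconvex (2 * n + 2) (code_Cn n)"
proof -
  have "realizable_without (2 * n + 2) (code_Cn n) i" if "i \<in> {1..2 * n + 2}" for i
    using that
  proof (cases rule: neuron_cases)
    case 1
    then show ?thesis by (rule Cn_realizable_without_facet[OF assms])
  next
    case 2
    then show ?thesis using Cn_realizable_without_union[OF assms] by simp
  next
    case (3 k)
    show ?thesis
    proof (cases "k = n + 1")
      case True
      then show ?thesis using Cn_realizable_without_center_petal[OF assms] 3(2) by simp
    next
      case False
      then have "k \<in> {1..n}" using 3(1) by auto
      then show ?thesis unfolding 3(2) by (rule Cn_realizable_without_petal[OF assms])
    qed
  qed
  then have "convex_code M D" if "is_code M D" "code_less (M, D) (2 * n + 2, code_Cn n)" for M D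
    using convex_below[OF is_code_Cn[OF assms] _ _ that] Cn_trunks_incomparable[OF assms] by blast
  then show ?thesis
    unfolding minimally_nonconvex_def using is_code_Cn[OF assms] Cn_not_convex[OF assms] by blast
qed

end
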